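(* For any integer $d\ge 3$, the maximal $\mathbb{R}$-degree of the evolutes $E_\Gamma$, where $\Gamma$ runs over all real-algebraic curves $\Gamma\subset\mathbb{R}^2$ of degree $d$, is not less than $d(d-2)$.
   Context: The evolute $E_\Gamma\subset\mathbb{R}^2$ of a plane curve $\Gamma\subset \mathbb{R}^2$ is the locus of its centers of curvature; equivalently, it is the envelope of the family of normals to $\Gamma$, where a normal is an affine line perpendicular to the tangent line of $\Gamma$ at some point of $\Gamma$. For a local parametrization $(x(t),y(t))$ of $\Gamma$ the evolute is parametrized by $X=x-\frac{y'(x'^2+y'^2)}{x'y''-x''y'}$, $Y=y+\frac{x'(x'^2+y'^2)}{x'y''-x''y'}$. The $\mathbb{R}$-degree of a real algebraic hypersurface $H\subset\mathbb{R}^n$ is the supremum of the cardinality of $H\cap L$ taken over all (real affine) lines $L\subset\mathbb{R}^n$ that intersect $H$ transversally. *)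

theory Defs
  imports
    "HOL-Analysis.Analysis"
    "HOL-Computational_Algebra.Polynomial"
    "HOL-Library.Extended_Nat"
begin

text \<open>
  A polynomial in two variables is an element of \<open>\<real>[x][y]\<close>: the coefficient of \<open>x\<^sup>i y\<^sup>j\<close> in \<open>f\<close>
  is \<open>coeff (coeff f j) i\<close>.
\<close>

definition eval2 :: "real poly poly \<Rightarrow> real \<times> real \<Rightarrow> real" where
  "eval2 f p = poly (poly f [:snd p:]) (fst p)"

text \<open>
  A zero coefficient has degree 0, so it contributes only an index \<open>j \<le> degree f\<close>, which never
  exceeds the contribution of the leading coefficient; the zero polynomial gets total degree 0.
\<close>

definition total_degree :: "real poly poly \<Rightarrow> nat" where
  "total_degree f = Max ((\<lambda>j. j + degree (coeff f j)) ` {..degree f})"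

definition zero_locus :: "real poly poly set \<Rightarrow> (real \<times> real) set" where
  "zero_locus F = {p. \<forall>f\<in>F. eval2 f p = 0}"

definition vanishing_ideal :: "(real \<times> real) set \<Rightarrow> real poly poly set" where
  "vanishing_ideal S = {f. \<forall>p\<in>S. eval2 f p = 0}"

definition zariski_closure :: "(real \<times> real) set \<Rightarrow> (real \<times> real) set" where
  "zariski_closure S = zero_locus (vanishing_ideal S)"

text \<open>
  The degree of a curve given as a subset of the plane is the degree of a generator of its vanishing
  ideal. Asking only that \<open>\<Gamma>\<close> be the zero set of some polynomial of degree \<open>d\<close> would not determine
  \<open>d\<close>: the factor \<open>x\<^sup>2 + y\<^sup>2 + 1\<close> changes the degree but not the real zero set. For \<open>d > 0\<close> the
  condition forces \<open>\<Gamma>\<close> to be infinite, because the vanishing ideal of a finite nonempty set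
  is not principal and that of the empty set is generated by 1. Reducible and singular curves
  are allowed.
\<close>

definition real_algebraic_curve :: "nat \<Rightarrow> (real \<times> real) set \<Rightarrow> bool" where
  "real_algebraic_curve d \<Gamma> \<longleftrightarrow>
     (\<exists>f. total_degree f = d \<and> \<Gamma> = zero_locus {f} \<and> vanishing_ideal \<Gamma> = {g. f dvd g})"

definition C2_on :: "real set \<Rightarrow> (real \<Rightarrow> real) \<Rightarrow> (real \<Rightarrow> real) \<Rightarrow> (real \<Rightarrow> real) \<Rightarrow> bool" where
  "C2_on I x x' x'' \<longleftrightarrow>
     (\<forall>t\<in>I. (x has_real_derivative x' t) (at t)) \<and>
     (\<forall>t\<in>I. (x' has_real_derivative x'' t) (at t)) \<and>
     continuous_on I x''"

text \<open>
  The locus of the centers of curvature. The nonvanishing of \<open>x' y'' - x'' y'\<close> says that the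
  parametrization is regular at \<open>t\<close> and that the curvature there is not zero. At a multiple point
  of \<open>\<Gamma>\<close> every branch admitting such a parametrization contributes.
\<close>

definition evolute :: "(real \<times> real) set \<Rightarrow> (real \<times> real) set" where
  "evolute \<Gamma> =
     {(x t - y' t * ((x' t)\<^sup>2 + (y' t)\<^sup>2) / (x' t * y'' t - x'' t * y' t),
       y t + x' t * ((x' t)\<^sup>2 + (y' t)\<^sup>2) / (x' t * y'' t - x'' t * y' t))
      | x y x' y' x'' y'' I t.
        open I \<and> connected I \<and> t \<in> I \<and> C2_on I x x' x'' \<and> C2_on I y y' y'' \<and>
        (\<forall>s\<in>I. (x s, y s) \<in> \<Gamma>) \<and> x' t * y'' t - x'' t * y' t \<noteq> 0}"

text \<open>The Zariski tangent space at \<open>p\<close>, as a linear subspace of \<open>\<real>\<^sup>2\<close>.\<close>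

definition tangent_space :: "(real \<times> real) set \<Rightarrow> real \<times> real \<Rightarrow> (real \<times> real) set" where
  "tangent_space H p =
     {v. \<forall>g\<in>vanishing_ideal H. ((\<lambda>t. eval2 g (p + t *\<^sub>R v)) has_real_derivative 0) (at 0)}"

definition is_line :: "(real \<times> real) set \<Rightarrow> bool" where
  "is_line L \<longleftrightarrow> affine L \<and> aff_dim L = 1"

text \<open>
  The line meets the hypersurface only at nonsingular points (tangent space of dimension 1) and is
  not tangent to it there. The locus of centers of curvature need not be Zariski closed, so the
  condition is imposed at all points of the algebraic set that \<open>H\<close> spans, whereas the \<open>\<real>\<close>-degree
  below counts only points of \<open>H\<close> itself. For algebraic \<open>H\<close> the two sets coincide.
\<close>

definition meets_transversally :: "(real \<times> real) set \<Rightarrow> (real \<times> real) set \<Rightarrow> bool" where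
  "meets_transversally L H \<longleftrightarrow>
     (\<forall>p \<in> zariski_closure H \<inter> L.
        dim (tangent_space H p) = 1 \<and> (\<forall>q\<in>L. q - p \<in> tangent_space H p \<longrightarrow> q = p))"

definition ecard :: "'a set \<Rightarrow> enat" where
  "ecard A = (if finite A then enat (card A) else \<infinity>)"

definition R_degree :: "(real \<times> real) set \<Rightarrow> enat" where
  "R_degree H = (SUP L \<in> {L. is_line L \<and> meets_transversally L H}. ecard (H \<inter> L))"

end

theory Submission
  imports Defs
begin

text \<open>
  The curve is a smoothing of a line arrangement. For \<open>d\<close> lines in general position with product \<open>F\<close>,
  the curve \<open>F = \<epsilon>\<close> with small \<open>\<epsilon> > 0\<close> has degree \<open>d\<close> and runs close to the lines. Along a line and
  away from the nodes it is almost straight, so the center of curvature is far away. Close to a node it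
  turns sharply from one line to the other, so the center is close to the node. In between, the
  center has to travel the distance, and it does so almost along the normal of the line at the
  node; the two sides of the node give the two rays of this normal. Hence for \<open>\<epsilon> \<rightarrow> 0\<close> the evolute
  accumulates at \<open>d (d - 1)\<close> full lines, namely for each node the normals of the two lines through
  it. A line \<open>L\<close> that meets these normals in \<open>d (d - 1)\<close> distinct points therefore meets the evolute
  near each of these points. This gives \<open>d (d - 1) \<ge> d (d - 2)\<close> points.

  Three things have to be made precise.

  The limit. Put \<open>\<epsilon> = \<delta>\<^sup>3\<close> and use at a node the coordinates \<open>x = a + \<delta> s\<close> and \<open>\<delta>\<^sup>2 w\<close> for
  the height over the line \<open>y = m x + b\<close>. In these coordinates the equation divided by \<open>\<delta>\<^sup>3\<close> is a
  polynomial in \<open>(\<delta>, s, w)\<close> that becomes \<open>\<kappa> s w = 1\<close> for \<open>\<delta> = 0\<close>, and the center of curvature extends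
  smoothly to \<open>\<delta> = 0\<close>, where it moves on the normal. So the points of the evolute on \<open>L\<close> are the
  solutions of a system of equations that is nondegenerate at \<open>\<delta> = 0\<close>, and an open mapping
  argument yields solutions for all small \<open>\<delta>\<close> and all lines close to \<open>L\<close>
  (\<open>nodal_branch_centers\<close>, \<open>evolute_near_node_normal\<close>).

  The degree. The lines are chosen such that \<open>F(x, \<cdot>) = \<epsilon>\<close> has \<open>d\<close> distinct real solutions for
  every \<open>x \<le> 0\<close>. As \<open>F\<close> is monic in \<open>y\<close>, this forces every polynomial vanishing on the curve to be a
  multiple of \<open>F - \<epsilon>\<close> (\<open>smoothed_lines_vanishing_ideal\<close>).

  Transversality. The evolute lies on an algebraic curve: by a dimension count, the two coordinates of
  the center of curvature satisfy a polynomial relation on the curve (\<open>evolute_algebraic\<close>). For a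
  subset of an algebraic curve all but finitely many vertical lines are transversal
  (\<open>generic_vertical_line_transversal\<close>). Since the first step works for an interval of vertical
  lines, one of them is transversal.
\<close>

section \<open>Evaluation and differentiation of polynomials in two variables\<close>

lemma eval2_0 [simp]: "eval2 0 p = 0"
  and eval2_pCons [simp]: "eval2 (pCons a f) p = poly a (fst p) + snd p * eval2 f p"
  and eval2_1 [simp]: "eval2 1 p = 1"
  and eval2_add [simp]: "eval2 (f + g) p = eval2 f p + eval2 g p"
  and eval2_diff [simp]: "eval2 (f - g) p = eval2 f p - eval2 g p"
  and eval2_mult [simp]: "eval2 (f * g) p = eval2 f p * eval2 g p"
  and eval2_smult [simp]: "eval2 (smult a f) p = poly a (fst p) * eval2 f p"
  by (simp_all add: eval2_def)

lemma eval2_prod [simp]: "eval2 (prod f A) p = (\<Prod>a\<in>A. eval2 (f a) p)"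
  by (induction A rule: infinite_finite_induct) auto

lemma eval2_sum [simp]: "eval2 (sum f A) p = (\<Sum>a\<in>A. eval2 (f a) p)"
  by (induction A rule: infinite_finite_induct) auto

lemma eval2_numeral [simp]: "eval2 (numeral n) p = numeral n"
  by (simp add: eval2_def)

lemma eval2_monom [simp]: "eval2 (monom a k) p = poly a (fst p) * snd p ^ k"
  by (simp add: eval2_def poly_monom)

lemma eval2_power [simp]: "eval2 (f ^ k) p = eval2 f p ^ k"
  by (induction k) auto

definition slice :: "real poly poly \<Rightarrow> real \<Rightarrow> real poly" where
  "slice f c = map_poly (\<lambda>a. poly a c) f"

lemma coeff_slice [simp]: "coeff (slice f c) k = poly (coeff f k) c"
  by (simp add: slice_def coeff_map_poly)

lemma slice_pCons [simp]: "slice (pCons a f) c = pCons (poly a c) (slice f c)"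
  by (simp add: slice_def map_poly_pCons)

lemma slice_0 [simp]: "slice 0 c = 0"
  by (simp add: slice_def)

lemma poly_slice [simp]: "poly (slice f c) y = eval2 f (c, y)"
  by (induction f) auto

lemma slice_mult [simp]: "slice (f * g) c = slice f c * slice g c"
  and slice_smult [simp]: "slice (smult a f) c = smult (poly a c) (slice f c)"
  by (simp_all add: poly_eq_poly_eq_iff [symmetric] fun_eq_iff)

lemma slice_pderiv: "slice (pderiv f) c = pderiv (slice f c)"
  by (rule poly_eqI) (simp add: coeff_pderiv)

text \<open>
  As \<open>y\<close> is the main variable, \<open>pderiv\<close> is the partial derivative with respect to \<open>y\<close>, and the one
  with respect to \<open>x\<close> acts on the coefficients.
\<close>

abbreviation dx :: "real poly poly \<Rightarrow> real poly poly" where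
  "dx \<equiv> map_poly pderiv"

lemma eval2_has_derivative:
  "(eval2 f has_derivative
     (\<lambda>v. eval2 (dx f) p * fst v + eval2 (pderiv f) p * snd v)) (at p)"
proof (induction f)
  case 0
  then show ?case by simp
next
  case (pCons a f)
  have a: "((\<lambda>p. poly a (fst p)) has_derivative (\<lambda>v. poly (pderiv a) (fst p) * fst v)) (at p)"
    using DERIV_compose_FDERIV [OF poly_DERIV [of a] has_derivative_fst [OF has_derivative_ident]]
    by (simp only: mult.commute)
  have eq: "eval2 (pCons a f) = (\<lambda>p. poly a (fst p) + snd p * eval2 f p)"
    by (simp add: fun_eq_iff)
  show ?case
    unfolding eq
    by (rule derivative_eq_intros a pCons(2) has_derivative_snd has_derivative_ident | simp)+
       (simp add: map_poly_pCons pderiv_pCons algebra_simps fun_eq_iff)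
qed


section \<open>Generic vertical lines are transversal\<close>

lemma in_vanishing_ideal_iff:
  "f \<in> vanishing_ideal S \<longleftrightarrow> (\<forall>p\<in>S. eval2 f p = 0)"
  by (simp add: vanishing_ideal_def)

text \<open>
  Up to a constant, \<open>m\<close> divides \<open>g'\<close>, so its multiplicity at \<open>y\<close> is smaller than that of \<open>g\<close>; the
  missing factor is in \<open>q\<close>.
\<close>

lemma cofactor_root:
  fixes g :: "real poly"
  assumes "g \<noteq> 0" "poly g y = 0" "a \<noteq> 0" "b \<noteq> 0"
    and g: "smult a g = m * q" and g': "smult b (pderiv g) = m * q'"
  shows "poly q y = 0"
proof -
  have "pderiv g \<noteq> 0"
  proof
    assume "pderiv g = 0"
    then obtain c where "g = [:c:]" by (metis pderiv_iszero)
    then show False using assms by simp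
  qed
  then have nz': "m * q' \<noteq> 0" using assms(4) by (simp flip: g')
  have nz: "m * q \<noteq> 0" using assms by (simp flip: g)
  have "order y m \<le> order y (smult b (pderiv g))"
    unfolding g' order_mult [OF nz'] by simp
  also have "\<dots> < order y (smult a g)"
    using order_pderiv [OF assms(1,2)] assms(3,4) by (simp add: order_smult)
  also have "\<dots> = order y m + order y q"
    unfolding g order_mult [OF nz] by simp
  finally show ?thesis
    using order_root by auto
qed

text \<open>
  A gcd argument over the field \<open>\<real>(x)\<close>, with denominators cleared. Among the combinations
  \<open>u g + v g\<^sub>y\<close> take a nonzero one, \<open>m\<close>, of minimal degree in \<open>y\<close>. It divides \<open>g\<close> and \<open>g\<^sub>y\<close> up to factors
  from \<open>\<real>[x]\<close>. By \<open>cofactor_root\<close>, the cofactor of \<open>m\<close> in \<open>g\<close> still vanishes at the points of \<open>S\<close>, after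
  multiplication by a polynomial in \<open>x\<close>, and by minimality of \<open>g\<close> it cannot have smaller degree. So \<open>m\<close> is a polynomial in \<open>x\<close> alone, and \<open>g\<close> and \<open>g\<^sub>y\<close>
  have a common zero only over the zeros of \<open>m\<close>.
\<close>

lemma minimal_degree_generic_simple_zeros:
  assumes gS: "g \<in> vanishing_ideal S" and g0: "g \<noteq> 0"
    and min: "\<And>h. h \<in> vanishing_ideal S \<Longrightarrow> h \<noteq> 0 \<Longrightarrow> degree g \<le> degree h"
  obtains r where "r \<noteq> 0" "\<And>c. poly r c \<noteq> 0 \<Longrightarrow> poly (lead_coeff g) c \<noteq> 0"
    "\<And>c y. poly r c \<noteq> 0 \<Longrightarrow> eval2 g (c, y) = 0 \<Longrightarrow> eval2 (pderiv g) (c, y) \<noteq> 0"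
proof (cases "degree g = 0")
  case True
  then obtain a where "g = [:a:]" by (metis degree_eq_zeroE)
  with g0 show ?thesis by (intro that [of a]) auto
next
  case False
  define J where "J = {u * g + v * pderiv g | u v. True}"
  have gJ: "g \<in> J" "pderiv g \<in> J"
    unfolding J_def by (force intro: exI [of _ 0] exI [of _ 1])+
  have J_diff: "smult a k - m * q \<in> J" if "k \<in> J" "m \<in> J" for a k m q
  proof -
    from that obtain u v u' v' where "k = u * g + v * pderiv g" "m = u' * g + v' * pderiv g"
      by (auto simp: J_def)
    then have "smult a k - m * q
        = (smult a u - u' * q) * g + (smult a v - v' * q) * pderiv g"
      by (simp add: algebra_simps smult_add_right)
    then show ?thesis unfolding J_def by blast
  qed
  obtain m where m: "m \<in> J" "m \<noteq> 0" "\<And>k. k \<in> J \<Longrightarrow> k \<noteq> 0 \<Longrightarrow> degree m \<le> degree k"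
    using ex_has_least_nat [of "\<lambda>k. k \<in> J \<and> k \<noteq> 0" g degree] gJ g0 by blast
  have div: "\<exists>a q. a \<noteq> 0 \<and> smult a k = m * q" if "k \<in> J" for k
  proof -
    obtain a q where aq: "a \<noteq> 0" "smult a k = m * q + pseudo_mod k m"
      using pseudo_mod(1) [OF m(2)] by blast
    then have "pseudo_mod k m = smult a k - m * q" by simp
    with J_diff [OF that m(1)] have "pseudo_mod k m \<in> J" by simp
    then have "pseudo_mod k m = 0"
      using pseudo_mod(2) [OF m(2), of k] m(3) by force
    with aq show ?thesis by auto
  qed
  obtain a q where q: "a \<noteq> 0" "smult a g = m * q" using div gJ by blast
  obtain b q' where q': "b \<noteq> 0" "smult b (pderiv g) = m * q'" using div gJ by blast
  have qnz: "q \<noteq> 0" using q g0 by auto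
  \<comment> \<open>The factor makes the product vanish over those \<open>c\<close> where \<open>cofactor_root\<close> does not apply.\<close>
  have "smult (a * b * lead_coeff g) q \<in> vanishing_ideal S"
    unfolding in_vanishing_ideal_iff
  proof
    fix p assume p: "p \<in> S"
    obtain c y where cy: "p = (c, y)" by force
    show "eval2 (smult (a * b * lead_coeff g) q) p = 0"
    proof (cases "poly (a * b * lead_coeff g) c = 0")
      case False
      have "slice g c \<noteq> 0"
        using False coeff_slice [of g c "degree g"] by (intro notI) simp
      moreover have "poly (slice g c) y = 0" using gS p cy by (simp add: vanishing_ideal_def)
      moreover have "smult (poly a c) (slice g c) = slice m c * slice q c"
        using arg_cong [OF q(2), of "\<lambda>f. slice f c"] by simp
      moreover have "smult (poly b c) (pderiv (slice g c)) = slice m c * slice q' c"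
        using arg_cong [OF q'(2), of "\<lambda>f. slice f c"] by (simp add: slice_pderiv)
      ultimately have "poly (slice q c) y = 0"
        using False cofactor_root [of "slice g c" y "poly a c" "poly b c" "slice m c" "slice q c"
          "slice q' c"]
        by (simp del: poly_slice)
      then show ?thesis by (simp add: cy)
    qed (simp add: cy)
  qed
  moreover have "smult (a * b * lead_coeff g) q \<noteq> 0"
    using q q' qnz g0 by auto
  ultimately have "degree g \<le> degree q"
    using min q(1) q'(1) g0 by fastforce
  moreover have "degree g = degree m + degree q"
    using arg_cong [OF q(2), of degree] q(1) m(2) qnz by (simp add: degree_mult_eq)
  ultimately have "degree m = 0" by simp
  then obtain s where s: "m = [:s:]" by (metis degree_eq_zeroE)
  obtain u v where uv: "m = u * g + v * pderiv g" using m(1) by (auto simp: J_def)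
  show ?thesis
  proof (rule that [of "s * lead_coeff g"])
    show "s * lead_coeff g \<noteq> 0" using s m(2) g0 by auto
    fix c y
    assume *: "poly (s * lead_coeff g) c \<noteq> 0" and g: "eval2 g (c, y) = 0"
    show "eval2 (pderiv g) (c, y) \<noteq> 0"
    proof
      assume "eval2 (pderiv g) (c, y) = 0"
      with g have "eval2 m (c, y) = 0" by (simp add: uv)
      with * s show False by simp
    qed
  qed auto
qed

lemma minimal_degree_element:
  assumes "h \<in> vanishing_ideal S" "h \<noteq> 0"
  obtains g where "g \<in> vanishing_ideal S" "g \<noteq> 0"
    "\<And>h. h \<in> vanishing_ideal S \<Longrightarrow> h \<noteq> 0 \<Longrightarrow> degree g \<le> degree h"
  using ex_has_least_nat [of "\<lambda>h. h \<in> vanishing_ideal S \<and> h \<noteq> 0" h degree] assms by blast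

lemma vertical_line: "is_line {p::real \<times> real. fst p = c}"
proof -
  have "{p::real \<times> real. fst p = c} = {p. (1, 0) \<bullet> p = c}" by (auto simp: inner_Pair_0)
  then show ?thesis
    unfolding is_line_def by (simp add: affine_hyperplane aff_dim_hyperplane zero_prod_def)
qed

text \<open>
  Let \<open>g\<close> be a nonzero element of the vanishing ideal of minimal degree in \<open>y\<close>. Up to a power of its
  leading coefficient, \<open>g\<close> divides every \<open>h\<close> in the ideal. Where that coefficient is nonzero, the gradient of
  \<open>h\<close> at a point of the closure is therefore a multiple of the gradient of \<open>g\<close>, so that the latter alone cuts
  out the tangent space. For generic \<open>c\<close> moreover \<open>g\<^sub>y \<noteq> 0\<close> at all zeros of \<open>g\<close> over \<open>c\<close>, so the tangent
  space is a line and not vertical.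
\<close>

lemma generic_vertical_line_transversal:
  assumes "h \<in> vanishing_ideal S" "h \<noteq> 0"
  obtains r where "r \<noteq> 0"
    "\<And>c. poly r c \<noteq> 0 \<Longrightarrow> meets_transversally {p. fst p = c} S"
proof -
  obtain g where g: "g \<in> vanishing_ideal S" "g \<noteq> 0"
    and min: "\<And>h. h \<in> vanishing_ideal S \<Longrightarrow> h \<noteq> 0 \<Longrightarrow> degree g \<le> degree h"
    using minimal_degree_element assms by metis
  obtain r where r: "r \<noteq> 0" "\<And>c. poly r c \<noteq> 0 \<Longrightarrow> poly (lead_coeff g) c \<noteq> 0"
    "\<And>c y. poly r c \<noteq> 0 \<Longrightarrow> eval2 g (c, y) = 0 \<Longrightarrow> eval2 (pderiv g) (c, y) \<noteq> 0"
    using minimal_degree_generic_simple_zeros [OF g min] by metis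
  define D where
    "D = (\<lambda>f p v. eval2 (dx f) p * fst v + eval2 (pderiv f) p * snd v)"
  have D: "(eval2 f has_derivative D f p) (at p)" for f p
    unfolding D_def by (rule eval2_has_derivative)
  have deriv: "((\<lambda>t. eval2 f (p + t *\<^sub>R v)) has_real_derivative D f p v) (at 0)" for f p v
  proof -
    have "((\<lambda>t. p + t *\<^sub>R v) has_derivative (\<lambda>t. t *\<^sub>R v)) (at 0)"
      by (auto intro!: derivative_eq_intros)
    from has_derivative_compose [OF this, of "eval2 f" "D f p"] D
    have "((\<lambda>t. eval2 f (p + t *\<^sub>R v)) has_derivative (\<lambda>t. D f p (t *\<^sub>R v))) (at 0)"
      by simp
    moreover have "(\<lambda>t. D f p (t *\<^sub>R v)) = (*) (D f p v)"
      by (simp add: D_def fun_eq_iff algebra_simps)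
    ultimately show ?thesis by (simp add: has_field_derivative_def)
  qed
  show ?thesis
  proof (rule that [OF r(1)])
    fix c assume c: "poly r c \<noteq> 0"
    show "meets_transversally {p. fst p = c} S"
      unfolding meets_transversally_def
    proof (intro ballI conjI impI)
      fix p assume p: "p \<in> zariski_closure S \<inter> {p. fst p = c}"
      have vanish: "eval2 f p = 0" if "f \<in> vanishing_ideal S" for f
        using p that by (auto simp: zariski_closure_def zero_locus_def)
      define A B where "A = eval2 (dx g) p" and "B = eval2 (pderiv g) p"
      have "B \<noteq> 0"
        unfolding B_def using r(3) [OF c, of "snd p"] vanish [OF g(1)] p by (cases p) auto
      have Dg: "D g p v = (A, B) \<bullet> v" for v
        by (cases v) (simp add: D_def A_def B_def)
      \<comment> \<open>Differentiate \<open>a h = g q\<close> at \<open>p\<close>, where \<open>g\<close> and \<open>h\<close> vanish.\<close>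
      have Dh: "D h p v = 0" if h: "h \<in> vanishing_ideal S" and v: "D g p v = 0" for h v
      proof -
        define k where "k = Suc (degree h) - degree g"
        define a where "a = lead_coeff g ^ k"
        obtain q s where qs: "pseudo_divmod h g = (q, s)" by force
        have eq: "smult a h = g * q + s" and s: "s = 0 \<or> degree s < degree g"
          using pseudo_divmod [OF g(2) qs] by (simp_all add: a_def k_def)
        have "s = smult a h - g * q" using eq by simp
        then have "s \<in> vanishing_ideal S" using h g(1) by (auto simp: vanishing_ideal_def)
        then have "s = 0" using min s by force
        have "D (smult a h) p v = poly a (fst p) * D h p v"
        proof -
          have "eval2 (smult a h) = (\<lambda>p. eval2 [:a:] p * eval2 h p)"
            by (simp add: fun_eq_iff)
          then have "(eval2 (smult a h) has_derivative
              (\<lambda>v. eval2 [:a:] p * D h p v + D [:a:] p v * eval2 h p)) (at p)"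
            by (simp only: has_derivative_mult [OF D D])
          then
          have "(eval2 (smult a h) has_derivative (\<lambda>v. poly a (fst p) * D h p v)) (at p)"
            using vanish [OF h] by simp
          then show ?thesis using has_derivative_unique D by metis
        qed
        moreover have "D (g * q) p v = D g p v * eval2 q p"
        proof -
          have "eval2 (g * q) = (\<lambda>p. eval2 g p * eval2 q p)"
            by (simp add: fun_eq_iff)
          then have "(eval2 (g * q) has_derivative
              (\<lambda>v. eval2 g p * D q p v + D g p v * eval2 q p)) (at p)"
            by (simp only: has_derivative_mult [OF D D])
          then
          have "(eval2 (g * q) has_derivative (\<lambda>v. D g p v * eval2 q p)) (at p)"
            using vanish [OF g(1)] by simp
          then show ?thesis using has_derivative_unique D by metis
        qed
        moreover have "poly a (fst p) \<noteq> 0"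
          using r(2) [OF c] p by (simp add: a_def)
        ultimately show ?thesis using eq v \<open>s = 0\<close> by simp
      qed
      have T: "tangent_space S p = {v. (A, B) \<bullet> v = 0}"
      proof (intro equalityI subsetI CollectI)
        fix v assume "v \<in> tangent_space S p"
        then show "(A, B) \<bullet> v = 0"
          using g(1) deriv DERIV_unique unfolding tangent_space_def Dg [symmetric] by blast
      next
        fix v assume "v \<in> {v. (A, B) \<bullet> v = 0}"
        then have "((\<lambda>t. eval2 h (p + t *\<^sub>R v)) has_real_derivative 0) (at 0)"
          if "h \<in> vanishing_ideal S" for h
          using deriv [of h p v] Dh [OF that, of v] Dg by simp
        then show "v \<in> tangent_space S p"
          unfolding tangent_space_def by blast
      qed
      show "dim (tangent_space S p) = 1"
        unfolding T using \<open>B \<noteq> 0\<close> by (subst dim_hyperplane) (auto simp: zero_prod_def)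
      fix q assume "q \<in> {p. fst p = c}" "q - p \<in> tangent_space S p"
      then show "q = p" using p \<open>B \<noteq> 0\<close> unfolding T by (cases p; cases q) auto
    qed
  qed
qed

section \<open>Smoothed line arrangements\<close>

text \<open>
  A bound for the total degree. Zero coefficients are exempted because they occur at all indices
  \<open>j > n\<close>.
\<close>

definition deg_le :: "nat \<Rightarrow> real poly poly \<Rightarrow> bool" where
  "deg_le n f \<longleftrightarrow> (\<forall>j. coeff f j \<noteq> 0 \<longrightarrow> j + degree (coeff f j) \<le> n)"

lemma deg_le_mult:
  assumes "deg_le m f" "deg_le n g"
  shows "deg_le (m + n) (f * g)"
  unfolding deg_le_def
proof (intro allI impI)
  fix k assume nz: "coeff (f * g) k \<noteq> 0"
  have bound: "k + degree (coeff f i * coeff g (k - i)) \<le> m + n"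
    if "i \<le> k" "coeff f i * coeff g (k - i) \<noteq> 0" for i
  proof -
    have "i + degree (coeff f i) \<le> m" "k - i + degree (coeff g (k - i)) \<le> n"
      using assms that by (auto simp: deg_le_def)
    moreover have "degree (coeff f i * coeff g (k - i)) \<le> degree (coeff f i) + degree (coeff g (k - i))"
      by (rule degree_mult_le)
    ultimately show ?thesis using that(1) by linarith
  qed
  obtain i where "i \<le> k" "coeff f i * coeff g (k - i) \<noteq> 0"
    using nz unfolding coeff_mult by (meson atMost_iff sum.neutral)
  with bound have k: "k \<le> m + n" by fastforce
  have "degree (coeff (f * g) k) \<le> m + n - k"
    unfolding coeff_mult
  proof (rule degree_sum_le)
    fix i assume i: "i \<in> {..k}"
    show "degree (coeff f i * coeff g (k - i)) \<le> m + n - k"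
      using bound [of i] i by (cases "coeff f i * coeff g (k - i) = 0") auto
  qed simp
  with k show "k + degree (coeff (f * g) k) \<le> m + n" by linarith
qed

lemma monic_total_degree:
  assumes "lead_coeff f = 1" "deg_le (degree f) f"
  shows "total_degree f = degree f"
  unfolding total_degree_def
proof (rule Max_eqI)
  fix n assume "n \<in> (\<lambda>j. j + degree (coeff f j)) ` {..degree f}"
  then obtain j where "j \<le> degree f" "n = j + degree (coeff f j)" by auto
  with assms(2) show "n \<le> degree f"
    by (cases "coeff f j = 0") (auto simp: deg_le_def)
qed (use assms(1) in \<open>auto intro!: image_eqI [of _ _ "degree f"]\<close>)

text \<open>
  Divide \<open>g\<close> by \<open>f\<close> with remainder, as \<open>f\<close> is monic in \<open>y\<close>. Over almost every \<open>x \<in> X\<close> a nonzero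
  remainder would be a nonzero polynomial in \<open>y\<close> of degree less than \<open>degree f\<close> that vanishes at
  \<open>degree f\<close> points.
\<close>

lemma vanishing_ideal_monic:
  assumes lc: "lead_coeff f = 1" and X: "infinite X"
    and roots: "\<And>x. x \<in> X \<Longrightarrow> \<exists>Y. card Y = degree f \<and> (\<forall>y\<in>Y. eval2 f (x, y) = 0)"
  shows "vanishing_ideal (zero_locus {f}) = {g. f dvd g}"
proof (intro equalityI subsetI)
  fix g assume "g \<in> {g. f dvd g}"
  then show "g \<in> vanishing_ideal (zero_locus {f})"
    by (auto simp: vanishing_ideal_def zero_locus_def)
next
  fix g assume g: "g \<in> vanishing_ideal (zero_locus {f})"
  obtain q r where qr: "pseudo_divmod g f = (q, r)" by force
  have f0: "f \<noteq> 0" using lc by auto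
  have eq: "g = f * q + r" and r: "r = 0 \<or> degree r < degree f"
    using pseudo_divmod [OF f0 qr] lc by simp_all
  have r_eq: "r = g - f * q" using eq by simp
  have "r = 0"
  proof (rule ccontr)
    assume r0: "r \<noteq> 0"
    then have "finite {x. poly (lead_coeff r) x = 0}"
      by (intro poly_roots_finite) simp
    then obtain x where x: "x \<in> X" "poly (lead_coeff r) x \<noteq> 0"
      using X by (metis (mono_tags, lifting) finite_subset mem_Collect_eq subsetI)
    obtain Y where Y: "card Y = degree f" "\<And>y. y \<in> Y \<Longrightarrow> eval2 f (x, y) = 0"
      using roots [OF x(1)] by blast
    have s0: "slice r x \<noteq> 0"
      using x(2) coeff_slice [of r x "degree r"] by (intro notI) simp
    have "Y \<subseteq> {y. poly (slice r x) y = 0}"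
      using Y(2) g by (auto simp: r_eq vanishing_ideal_def zero_locus_def)
    then have "degree f \<le> card {y. poly (slice r x) y = 0}"
      unfolding Y(1) [symmetric] by (intro card_mono poly_roots_finite s0)
    also have "\<dots> \<le> degree (slice r x)" by (rule card_poly_roots_bound [OF s0])
    also have "\<dots> \<le> degree r" by (rule degree_le) (simp add: coeff_eq_0)
    finally show False using r r0 by simp
  qed
  with eq show "g \<in> {g. f dvd g}" by simp
qed

text \<open>
  The line \<open>y = i x - i\<^sup>2\<close>, tangent to the parabola \<open>4 y = x\<^sup>2\<close> at \<open>x = 2 i\<close>. Two such lines meet in
  the point \<open>(i + j, i j)\<close>, so all nodes of the arrangement are explicit.
\<close>

definition tangent_line :: "nat \<Rightarrow> real poly poly" where
  "tangent_line i = [:[:(real i)\<^sup>2, - real i:], 1:]"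

definition smoothed_lines :: "nat \<Rightarrow> real \<Rightarrow> real poly poly" where
  "smoothed_lines d e = (\<Prod>i=1..d. tangent_line i) - [:[:e:]:]"

lemma eval2_smoothed_lines:
  "eval2 (smoothed_lines d e) (x, y) = (\<Prod>i=1..d. y - real i * x + (real i)\<^sup>2) - e"
proof -
  have "eval2 (tangent_line i) (x, y) = y - real i * x + (real i)\<^sup>2" for i
    by (simp add: tangent_line_def algebra_simps)
  then show ?thesis by (simp add: smoothed_lines_def)
qed

lemma smoothed_lines_monic:
  assumes "d > 0"
  shows "degree (smoothed_lines d e) = d" "lead_coeff (smoothed_lines d e) = 1"
    "deg_le d (smoothed_lines d e)"
proof -
  define P where "P k = (\<Prod>i=1..k. tangent_line i)" for k
  have P: "degree (P k) = k \<and> lead_coeff (P k) = 1 \<and> deg_le k (P k)" for k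
  proof (induction k)
    case 0
    then show ?case by (simp add: P_def deg_le_def coeff_1)
  next
    case (Suc k)
    have l: "degree (tangent_line i) = 1" "lead_coeff (tangent_line i) = 1" "deg_le 1 (tangent_line i)" for i
      by (auto simp: tangent_line_def deg_le_def coeff_pCons split: nat.split)
    have "P (Suc k) = P k * tangent_line (Suc k)" by (simp add: P_def mult.commute)
    moreover have "P k \<noteq> 0" "tangent_line (Suc k) \<noteq> 0" using Suc l(2) [of "Suc k"] by auto
    ultimately show ?case
      using Suc l [of "Suc k"] deg_le_mult [of k "P k" 1 "tangent_line (Suc k)"]
        coeff_mult_degree_sum [of "P k" "tangent_line (Suc k)"]
      by (auto simp: degree_mult_eq)
  qed
  have F: "smoothed_lines d e = P d - [:[:e:]:]" by (simp add: smoothed_lines_def P_def)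
  have c: "coeff (smoothed_lines d e) j = (if j = 0 then coeff (P d) 0 - [:e:] else coeff (P d) j)" for j
    by (cases j) (auto simp: F)
  show deg: "degree (smoothed_lines d e) = d"
  proof (rule antisym)
    show "degree (smoothed_lines d e) \<le> d"
      using assms P [of d] by (intro degree_le) (auto simp: c coeff_eq_0)
    show "d \<le> degree (smoothed_lines d e)"
      using assms P [of d] by (intro le_degree) (auto simp: c)
  qed
  show "lead_coeff (smoothed_lines d e) = 1"
    using assms P [of d] by (simp only: deg c) auto
  show "deg_le d (smoothed_lines d e)"
    unfolding deg_le_def
  proof (intro allI impI)
    fix j assume nz: "coeff (smoothed_lines d e) j \<noteq> 0"
    show "j + degree (coeff (smoothed_lines d e) j) \<le> d"
    proof (cases "j = 0")
      case True
      have "degree (coeff (P d) 0) \<le> d"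
        using P [of d] by (cases "coeff (P d) 0 = 0") (auto simp: deg_le_def)
      then show ?thesis by (simp add: True c degree_diff_le)
    next
      case False
      then show ?thesis using P [of d] nz by (simp add: c deg_le_def)
    qed
  qed
qed

lemma alternating_product:
  fixes t :: "nat \<Rightarrow> real"
  assumes "k \<le> d" "\<And>i. 1 \<le> i \<Longrightarrow> i \<le> k \<Longrightarrow> t i \<le> -1" "\<And>i. k < i \<Longrightarrow> i \<le> d \<Longrightarrow> t i \<ge> 1"
  shows "(-1) ^ k * (\<Prod>i=1..d. t i) \<ge> 1"
proof -
  have "(\<Prod>i=1..d. if i \<le> k then -1 else 1 :: real) = (\<Prod>i=1..k. -1)"
    using assms(1) by (intro prod.mono_neutral_cong_right) auto
  then have "(-1) ^ k * (\<Prod>i=1..d. t i) = (\<Prod>i=1..d. (if i \<le> k then -1 else 1) * t i)"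
    by (simp add: prod.distrib)
  also have "\<dots> \<ge> 1" using assms by (intro prod_ge_1) fastforce
  finally show ?thesis .
qed

text \<open>
  For \<open>x \<le> 0\<close> the heights \<open>i x - i\<^sup>2\<close> of the lines over \<open>x\<close> decrease in \<open>i\<close> with gaps larger than 1.
  There are test points \<open>z k\<close> that separate them and have distance at least 1 from all of them. So the product
  of the lines alternates in sign along the test points with absolute value at least \<open>1 > e\<close>.
\<close>

lemma smoothed_lines_real_roots:
  assumes e: "0 < e" "e < 1" and x: "x \<le> 0"
  shows "\<exists>Y. card Y = d \<and> (\<forall>y\<in>Y. eval2 (smoothed_lines d e) (x, y) = 0)"
proof -
  \<comment> \<open>\<open>z k\<close> is the height of line \<open>k\<close>, lowered by \<open>k\<close>; in particular \<open>z 0 = 0\<close> is above all lines.\<close>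
  define z where "z k = real k * x - (real k)\<^sup>2 - real k" for k :: nat
  define G where "G y = (\<Prod>i=1..d. y - real i * x + (real i)\<^sup>2)" for y
  have G: "(-1) ^ k * G (z k) \<ge> 1" if "k \<le> d" for k
    unfolding G_def
  proof (rule alternating_product [OF that])
    fix i assume i: "1 \<le> i" "i \<le> k"
    have "(real k - real i) * x \<le> 0" using i x by (intro mult_nonneg_nonpos) auto
    moreover have "(real i)\<^sup>2 \<le> (real k)\<^sup>2" using i by simp
    moreover have "real k \<ge> 1" using i by simp
    ultimately show "z k - real i * x + (real i)\<^sup>2 \<le> -1"
      unfolding z_def left_diff_distrib by linarith
  next
    fix i assume i: "k < i" "i \<le> d"
    have "(real k - real i) * x \<ge> 0" using i x by (intro mult_nonpos_nonpos) auto
    moreover have "(real k + 1)\<^sup>2 \<le> (real i)\<^sup>2" using i by simp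
    ultimately show "z k - real i * x + (real i)\<^sup>2 \<ge> 1"
      unfolding z_def left_diff_distrib power2_sum by simp
  qed
  have zdec: "z (Suc k) < z k" for k
    using x by (simp add: z_def power2_eq_square algebra_simps)
  have "\<exists>y. z (Suc k) < y \<and> y < z k \<and> G y = e" if k: "k < d" for k
  proof -
    have cont: "continuous_on {z (Suc k)..z k} G"
      unfolding G_def by (intro continuous_intros)
    have 1: "(-1) ^ k * G (z k) \<ge> 1" "- ((-1) ^ k * G (z (Suc k))) \<ge> 1"
      using G [of k] G [of "Suc k"] k by auto
    have "\<exists>y\<ge>z (Suc k). y \<le> z k \<and> G y = e"
    proof (cases "even k")
      case True
      then show ?thesis
        using 1 e zdec [of k] cont by (intro IVT') auto
    next
      case False
      then show ?thesis
        using 1 e zdec [of k] cont by (intro IVT2') auto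
    qed
    then obtain y where y: "z (Suc k) \<le> y" "y \<le> z k" "G y = e" by blast
    have "G (z k) \<noteq> e" "G (z (Suc k)) \<noteq> e"
      using 1 e by (cases "even k"; force)+
    with y show ?thesis by (metis order_less_le)
  qed
  then obtain y where y: "\<And>k. k < d \<Longrightarrow> z (Suc k) < y k \<and> y k < z k \<and> G (y k) = e"
    by metis
  have z_mono: "z l \<le> z k" if "k \<le> l" for k l
    using lift_Suc_antimono_le [of z k l] zdec that less_imp_le by blast
  have ylt: "y l < y k" if "k < l" "l < d" for k l
    using y [of k] y [of l] z_mono [of "Suc k" l] that by fastforce
  then have "inj_on y {..<d}"
    by (intro inj_onI) (metis lessThan_iff linorder_neqE_nat order_less_irrefl)
  then have "card (y ` {..<d}) = d" by (simp add: card_image)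
  moreover have "\<forall>t\<in>y ` {..<d}. eval2 (smoothed_lines d e) (x, t) = 0"
    using y by (auto simp: eval2_smoothed_lines G_def)
  ultimately show ?thesis by blast
qed

lemma smoothed_lines_vanishing_ideal:
  assumes "d > 0" "0 < e" "e < 1"
  shows "vanishing_ideal (zero_locus {smoothed_lines d e}) = {g. smoothed_lines d e dvd g}"
  using smoothed_lines_monic(1,2) [OF assms(1), of e] smoothed_lines_real_roots [OF assms(2,3)]
  by (intro vanishing_ideal_monic [of _ "{..0}"]) (auto simp: infinite_Iic)

lemma smoothed_lines_curve:
  assumes "d > 0" "0 < e" "e < 1"
  shows "real_algebraic_curve d (zero_locus {smoothed_lines d e})"
  unfolding real_algebraic_curve_def
  using smoothed_lines_vanishing_ideal [OF assms] smoothed_lines_monic [OF assms(1), of e]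
    monic_total_degree by metis

section \<open>The evolute lies on an algebraic curve\<close>

text \<open>
  Gaussian elimination: an equation with a nonzero coefficient is used to eliminate one unknown
  from the other equations.
\<close>

lemma underdetermined_system:
  fixes M :: "'a \<Rightarrow> 'b \<Rightarrow> real"
  assumes "finite B" "finite A" "card B < card A"
  shows "\<exists>c. (\<exists>a\<in>A. c a \<noteq> 0) \<and> (\<forall>b\<in>B. (\<Sum>a\<in>A. c a * M a b) = 0)"
  using assms
proof (induction B arbitrary: A M rule: finite_induct)
  case empty
  then obtain a where "a \<in> A" by fastforce
  then show ?case by (intro exI [of _ "\<lambda>_. 1"]) auto
next
  case (insert b B)
  show ?case
  proof (cases "\<forall>a\<in>A. M a b = 0")
    case True
    moreover have "card B < card A" using insert by simp
    ultimately show ?thesis using insert.IH [of A M] insert.prems by auto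
  next
    case False
    then obtain a0 where a0: "a0 \<in> A" "M a0 b \<noteq> 0" by blast
    define M' where "M' a k = M a k - M a b / M a0 b * M a0 k" for a k
    have "card B < card (A - {a0})" using insert a0 by (simp add: card_Diff_singleton)
    then obtain c where c: "\<exists>a\<in>A - {a0}. c a \<noteq> 0"
      "\<And>k. k \<in> B \<Longrightarrow> (\<Sum>a\<in>A - {a0}. c a * M' a k) = 0"
      using insert.IH [of "A - {a0}" M'] insert.prems by auto
    define c0 where "c0 = - (\<Sum>a\<in>A - {a0}. c a * M a b) / M a0 b"
    define c' where "c' = c(a0 := c0)"
    have split: "(\<Sum>a\<in>A. c' a * M a k) = c0 * M a0 k + (\<Sum>a\<in>A - {a0}. c a * M a k)" for k
      using a0 insert.prems by (subst sum.remove [of _ a0]) (auto simp: c'_def)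
    have "(\<Sum>a\<in>A. c' a * M a k) = (\<Sum>a\<in>A - {a0}. c a * M' a k)" for k
      unfolding split c0_def M'_def
      by (simp add: algebra_simps sum_subtractf sum_distrib_left sum_divide_distrib)
    moreover have "(\<Sum>a\<in>A. c' a * M a b) = 0"
      using a0 by (simp add: split c0_def)
    moreover have "\<exists>a\<in>A. c' a \<noteq> 0" using c(1) by (auto simp: c'_def)
    ultimately show ?thesis using c(2) by (intro exI [of _ c']) auto
  qed
qed

lemma deg_le_mono: "deg_le m f \<Longrightarrow> m \<le> n \<Longrightarrow> deg_le n f"
  by (fastforce simp: deg_le_def)

lemma deg_le_diff: "deg_le n f \<Longrightarrow> deg_le n g \<Longrightarrow> deg_le n (f - g)"
  unfolding deg_le_def
proof (intro allI impI)
  fix j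
  assume f: "\<forall>j. coeff f j \<noteq> 0 \<longrightarrow> j + degree (coeff f j) \<le> n"
    and g: "\<forall>j. coeff g j \<noteq> 0 \<longrightarrow> j + degree (coeff g j) \<le> n"
    and nz: "coeff (f - g) j \<noteq> 0"
  have jn: "j \<le> n" using f g nz by (metis add_leD1 coeff_diff diff_self)
  have "degree (coeff f j) \<le> n - j" "degree (coeff g j) \<le> n - j"
    using f g by (metis add_le_imp_le_diff add.commute degree_0 le0)+
  then have "degree (coeff (f - g) j) \<le> n - j" by (simp add: degree_diff_le)
  with jn show "j + degree (coeff (f - g) j) \<le> n" by simp
qed

lemma deg_le_1: "deg_le 0 1"
  by (simp add: deg_le_def coeff_1)

lemma deg_le_power: "deg_le n f \<Longrightarrow> deg_le (k * n) (f ^ k)"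
  by (induction k) (auto simp: deg_le_1 deg_le_mult)

lemma deg_le_exists: "\<exists>n. deg_le n f"
proof
  show "deg_le (degree f + (\<Sum>j\<le>degree f. degree (coeff f j))) f"
    unfolding deg_le_def
  proof (intro allI impI add_mono)
    fix j assume "coeff f j \<noteq> 0"
    then show j: "j \<le> degree f" by (rule le_degree)
    show "degree (coeff f j) \<le> (\<Sum>j\<le>degree f. degree (coeff f j))"
      using j by (intro member_le_sum) auto
  qed
qed

text \<open>
  A division step subtracts \<open>q f\<close> with \<open>q\<close> a multiple of a power of \<open>y\<close>. Since \<open>f\<close> is monic in \<open>y\<close> and its
  total degree is its degree in \<open>y\<close>, the total degree does not grow.
\<close>

lemma deg_le_remainder:
  assumes lc: "lead_coeff f = 1" and f: "deg_le (degree f) f" and d: "degree f > 0"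
  shows "deg_le n g \<Longrightarrow> \<exists>r. deg_le n r \<and> degree r < degree f \<and> f dvd g - r"
proof (induction "degree g" arbitrary: g rule: less_induct)
  case less
  show ?case
  proof (cases "degree g < degree f")
    case True
    then show ?thesis using less.prems by (intro exI [of _ g]) auto
  next
    case False
    define k where "k = degree g"
    define q where "q = monom (lead_coeff g) (k - degree f)"
    have kd: "degree f \<le> k" using False by (simp add: k_def)
    have g0: "lead_coeff g \<noteq> 0" using False d by auto
    have kn: "k + degree (lead_coeff g) \<le> n"
      using less.prems g0 by (auto simp: deg_le_def k_def)
    have "deg_le (n - degree f) q"
      using kn kd unfolding deg_le_def q_def by (auto simp: coeff_monom)
    from deg_le_mult [OF this f] have "deg_le n (q * f)"
      using kn kd by simp
    then have le: "deg_le n (g - q * f)" by (rule deg_le_diff [OF less.prems])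
    have dq: "degree q = k - degree f" using g0 by (simp add: q_def degree_monom_eq)
    have f0: "f \<noteq> 0" "q \<noteq> 0" using d g0 by (auto simp: q_def)
    have "degree (q * f) = k" using kd f0 by (simp add: degree_mult_eq dq)
    moreover have "lead_coeff (q * f) = lead_coeff g"
      using lc by (simp add: lead_coeff_mult dq) (simp add: q_def)
    ultimately have "coeff (g - q * f) k = 0" "degree (g - q * f) \<le> k"
      by (auto simp: k_def degree_diff_le)
    then have "degree (g - q * f) < k"
      using kd d by (metis eq_zero_or_degree_less degree_0 order.strict_trans2)
    then obtain r where "deg_le n r" "degree r < degree f" "f dvd (g - q * f) - r"
      using less.hyps le by (auto simp: k_def)
    moreover from this(3) have "f dvd ((g - q * f) - r) + q * f"
      by (rule dvd_add) simp
    ultimately show ?thesis by (intro exI [of _ r]) simp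
  qed
qed

text \<open>
  A dimension count. With a common degree bound \<open>m\<close> for \<open>u\<close>, \<open>v\<close>, \<open>h\<close>, the \<open>(D + 1)\<^sup>2\<close> polynomials
  \<open>u\<^sup>i v\<^sup>j h\<^bsup>2D-i-j\<^esup>\<close> with \<open>i, j \<le> D\<close> have total degree at most \<open>2 D m\<close>. Modulo \<open>f\<close> they lie in a space
  of dimension at most \<open>d (2 D m + 1)\<close>, which is smaller for large \<open>D\<close>. A linear relation modulo \<open>f\<close>
  becomes, after division by \<open>h\<^bsup>2D\<^esup>\<close>, an algebraic relation between \<open>u / h\<close> and \<open>v / h\<close>.
\<close>

lemma algebraic_relation_on_curve:
  assumes lc: "lead_coeff f = 1" and f: "deg_le (degree f) f" and d: "degree f > 0"
  shows "\<exists>P. P \<noteq> 0 \<and> (\<forall>p. eval2 f p = 0 \<longrightarrow> eval2 h p \<noteq> 0 \<longrightarrow>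
           eval2 P (eval2 u p / eval2 h p, eval2 v p / eval2 h p) = 0)"
proof -
  define d where "d = degree f"
  obtain mu mv mh where "deg_le mu u" "deg_le mv v" "deg_le mh h"
    using deg_le_exists by metis
  define m where "m = mu + mv + mh"
  have m: "deg_le m u" "deg_le m v" "deg_le m h"
    by (rule deg_le_mono, fact, simp add: m_def)+
  \<comment> \<open>This size gives \<open>d (2 D m + 1) < (D + 1)\<^sup>2\<close>, so that there are more unknowns than equations.\<close>
  define D where "D = 2 * d * m + d"
  define g where "g i j = u ^ i * v ^ j * h ^ (2 * D - i - j)" for i j
  have g: "deg_le (2 * D * m) (g i j)" if "i \<le> D" "j \<le> D" for i j
  proof -
    have "deg_le (i * m + j * m + (2 * D - i - j) * m) (g i j)"
      unfolding g_def by (intro deg_le_mult deg_le_power m)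
    moreover have "i * m + j * m + (2 * D - i - j) * m = 2 * D * m"
      using that by (simp flip: add_mult_distrib)
    ultimately show ?thesis by simp
  qed
  have "\<exists>r. deg_le (2 * D * m) r \<and> degree r < d \<and> f dvd g i j - r"
    if "i \<le> D" "j \<le> D" for i j
    using deg_le_remainder [OF assms g [OF that]] by (simp add: d_def)
  then obtain r where r: "\<And>i j. i \<le> D \<Longrightarrow> j \<le> D \<Longrightarrow>
      deg_le (2 * D * m) (r i j) \<and> degree (r i j) < d \<and> f dvd g i j - r i j"
    by metis
  define A where "A = {..D} \<times> {..D}"
  define B where "B = {..<d} \<times> {..2 * D * m}"
  have "card B < card A"
  proof -
    have "d * (2 * D * m + 1) = D * (2 * d * m) + d" by simp
    also have "\<dots> \<le> D * D + D" unfolding D_def by (intro add_mono mult_le_mono2) auto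
    also have "\<dots> < (D + 1) * (D + 1)" by simp
    finally show ?thesis by (simp add: A_def B_def)
  qed
  then obtain c where c0: "\<exists>a\<in>A. c a \<noteq> 0"
    and c: "\<And>b k. (b, k) \<in> B \<Longrightarrow> (\<Sum>(i, j)\<in>A. c (i, j) * coeff (coeff (r i j) b) k) = 0"
    using underdetermined_system [of B A "\<lambda>(i, j) (b, k). coeff (coeff (r i j) b) k"]
    by (auto simp: A_def B_def case_prod_unfold)
  have R0: "(\<Sum>(i, j)\<in>A. smult [:c (i, j):] (r i j)) = 0" (is "?R = 0")
  proof (rule poly_eqI, rule poly_eqI)
    fix b k
    have "coeff (coeff ?R b) k = (\<Sum>(i, j)\<in>A. c (i, j) * coeff (coeff (r i j) b) k)"
      by (simp add: coeff_sum case_prod_unfold)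
    also have "\<dots> = 0"
    proof (cases "(b, k) \<in> B")
      case False
      have "coeff (coeff (r i j) b) k = 0" if ij: "i \<le> D" "j \<le> D" for i j
      proof (cases "coeff (r i j) b = 0")
        case nz: False
        then have "b < d" using r [OF ij] le_degree [OF nz] by simp
        with False have "2 * D * m < k" by (auto simp: B_def)
        moreover have "b + degree (coeff (r i j) b) \<le> 2 * D * m"
          using r [OF ij] nz by (auto simp: deg_le_def)
        ultimately show ?thesis by (intro coeff_eq_0) simp
      qed simp
      then show ?thesis by (intro sum.neutral) (auto simp: A_def)
    qed (rule c)
    finally show "coeff (coeff ?R b) k = coeff (coeff 0 b) k" by simp
  qed
  define P where "P = (\<Sum>(i, j)\<in>A. monom (monom (c (i, j)) i) j)"
  have "P \<noteq> 0"
  proof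
    assume P0: "P = 0"
    obtain i j where ij: "(i, j) \<in> A" "c (i, j) \<noteq> 0" using c0 by auto
    have "coeff (coeff P j) i = (\<Sum>a\<in>A. if a = (i, j) then c a else 0)"
      unfolding P_def coeff_sum
      by (intro sum.cong refl) (auto simp: coeff_monom split: if_splits)
    also have "\<dots> = c (i, j)" using ij by (simp add: A_def)
    finally show False using P0 ij by simp
  qed
  moreover have "eval2 P (eval2 u p / eval2 h p, eval2 v p / eval2 h p) = 0"
    if p: "eval2 f p = 0" "eval2 h p \<noteq> 0" for p
  proof -
    have "0 = eval2 ?R p" by (simp only: R0 eval2_0)
    also have "\<dots> = (\<Sum>(i, j)\<in>A. c (i, j) * eval2 (r i j) p)"
      by (simp add: case_prod_unfold)
    also have "\<dots> = (\<Sum>(i, j)\<in>A. c (i, j) * eval2 (g i j) p)"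
    proof (intro sum.cong refl, clarify)
      fix i j assume "(i, j) \<in> A"
      then obtain q where "g i j - r i j = f * q"
        using r [of i j] by (auto simp: A_def elim: dvdE)
      then have "eval2 (g i j - r i j) p = 0" using p by simp
      then show "c (i, j) * eval2 (r i j) p = c (i, j) * eval2 (g i j) p" by simp
    qed
    also have "\<dots> = (\<Sum>(i, j)\<in>A. eval2 h p ^ (2 * D) *
        (c (i, j) * (eval2 u p / eval2 h p) ^ i * (eval2 v p / eval2 h p) ^ j))"
    proof (intro sum.cong refl, clarify)
      fix i j assume "(i, j) \<in> A"
      then have "eval2 h p ^ (2 * D) = eval2 h p ^ i * eval2 h p ^ j * eval2 h p ^ (2 * D - i - j)"
        by (simp add: A_def flip: power_add)
      then show "c (i, j) * eval2 (g i j) p = eval2 h p ^ (2 * D) *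
          (c (i, j) * (eval2 u p / eval2 h p) ^ i * (eval2 v p / eval2 h p) ^ j)"
        using p by (simp add: g_def power_divide)
    qed
    also have "\<dots> = eval2 h p ^ (2 * D) * eval2 P (eval2 u p / eval2 h p, eval2 v p / eval2 h p)"
      by (simp add: P_def sum_distrib_left case_prod_unfold poly_monom)
    finally show ?thesis using p by simp
  qed
  ultimately show ?thesis by blast
qed

lemma dx_pderiv_commute: "dx (pderiv f) = pderiv (dx f)"
proof (rule poly_eqI)
  fix k
  have "pderiv (of_nat n * a) = of_nat n * pderiv a" for n and a :: "real poly"
    by (simp add: pderiv_mult)
  then show "coeff (dx (pderiv f)) k = coeff (pderiv (dx f)) k"
    by (simp add: coeff_map_poly coeff_pderiv del: of_nat_Suc)
qed

lemma eval2_chain_rule: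
  assumes "(x has_real_derivative x') (at t)" "(y has_real_derivative y') (at t)"
  shows "((\<lambda>t. eval2 f (x t, y t)) has_real_derivative
           (eval2 (dx f) (x t, y t) * x' + eval2 (pderiv f) (x t, y t) * y')) (at t)"
proof -
  have "((\<lambda>t. (x t, y t)) has_derivative (\<lambda>h. (x' * h, y' * h))) (at t)"
    using assms unfolding has_field_derivative_def by (rule has_derivative_Pair)
  from has_derivative_compose [OF this eval2_has_derivative [of f]]
  show ?thesis
    unfolding has_field_derivative_def
    by (rule has_derivative_eq_rhs) (simp add: fun_eq_iff algebra_simps)
qed

definition grad_sq :: "real poly poly \<Rightarrow> real poly poly" where
  "grad_sq f = (dx f)\<^sup>2 + (pderiv f)\<^sup>2"

text \<open>
  The negative of the determinant of the Hessian of \<open>f\<close> bordered by its gradient. The curvature of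
  \<open>f = 0\<close> is, up to sign, this expression divided by the cube of the length of the gradient.
\<close>

definition bordered_hessian :: "real poly poly \<Rightarrow> real poly poly" where
  "bordered_hessian f = dx (dx f) * (pderiv f)\<^sup>2 - 2 * pderiv (dx f) * dx f * pderiv f
     + pderiv (pderiv f) * (dx f)\<^sup>2"

lemma deriv_zero_of_vanishing:
  assumes "open I" "t \<in> I" "\<And>s. s \<in> I \<Longrightarrow> g s = 0" "(g has_real_derivative D) (at t)"
  shows "D = 0"
proof -
  have "((\<lambda>s. 0) has_real_derivative D) (at t)"
    using assms(4,1,2) by (rule has_field_derivative_transform_within_open) (simp add: assms(3))
  then show ?thesis by (rule DERIV_unique [OF _ DERIV_const])
qed

text \<open>
  Differentiating \<open>f (x t, y t) = 0\<close> once shows that the velocity is \<open>l\<close> times the gradient turned by a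
  right angle; differentiating twice then expresses \<open>x' y'' - x'' y'\<close> as \<open>l\<^sup>3\<close> times the bordered Hessian. In
  the formula for the center the factor \<open>l\<close> cancels.
\<close>

lemma center_of_curvature_implicit:
  assumes I: "open I" "t \<in> I" and x: "C2_on I x x' x''" and y: "C2_on I y y' y''"
    and f: "\<forall>s\<in>I. eval2 f (x s, y s) = 0"
    and c: "x' t * y'' t - x'' t * y' t \<noteq> 0" and fy: "eval2 (pderiv f) (x t, y t) \<noteq> 0"
  defines "p \<equiv> (x t, y t)"
  shows "eval2 (bordered_hessian f) p \<noteq> 0"
    and "x t - y' t * ((x' t)\<^sup>2 + (y' t)\<^sup>2) / (x' t * y'' t - x'' t * y' t)
      = x t - eval2 (dx f) p * eval2 (grad_sq f) p / eval2 (bordered_hessian f) p"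
    and "y t + x' t * ((x' t)\<^sup>2 + (y' t)\<^sup>2) / (x' t * y'' t - x'' t * y' t)
      = y t - eval2 (pderiv f) p * eval2 (grad_sq f) p / eval2 (bordered_hessian f) p"
proof -
  have dxy: "(x has_real_derivative x' s) (at s)" "(y has_real_derivative y' s) (at s)"
    "(x' has_real_derivative x'' s) (at s)" "(y' has_real_derivative y'' s) (at s)"
    if "s \<in> I" for s
    using x y that by (auto simp: C2_on_def)
  have 1: "eval2 (dx f) (x s, y s) * x' s + eval2 (pderiv f) (x s, y s) * y' s = 0"
    if s: "s \<in> I" for s
  proof (rule deriv_zero_of_vanishing [OF I(1) s])
    show "((\<lambda>s. eval2 f (x s, y s)) has_real_derivative
        eval2 (dx f) (x s, y s) * x' s + eval2 (pderiv f) (x s, y s) * y' s) (at s)"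
      by (rule eval2_chain_rule [OF dxy(1,2) [OF s]])
  qed (use f in simp)
  define a b fxx fxy fyy where "a = eval2 (dx f) p" and "b = eval2 (pderiv f) p"
    and "fxx = eval2 (dx (dx f)) p" and "fxy = eval2 (pderiv (dx f)) p"
    and "fyy = eval2 (pderiv (pderiv f)) p"
  have eq1: "a * x' t + b * y' t = 0" using 1 [OF I(2)] by (simp add: a_def b_def p_def)
  have "((\<lambda>s. eval2 (dx f) (x s, y s) * x' s + eval2 (pderiv f) (x s, y s) * y' s)
      has_real_derivative ((fxx * x' t + fxy * y' t) * x' t + x'' t * a)
        + ((fxy * x' t + fyy * y' t) * y' t + y'' t * b)) (at t)"
    using DERIV_add [OF
        DERIV_mult [OF eval2_chain_rule [OF dxy(1,2) [OF I(2)], of "dx f"] dxy(3) [OF I(2)]]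
        DERIV_mult [OF eval2_chain_rule [OF dxy(1,2) [OF I(2)], of "pderiv f"] dxy(4) [OF I(2)]]]
    by (simp add: a_def b_def fxx_def fxy_def fyy_def p_def dx_pderiv_commute)
  from deriv_zero_of_vanishing [OF I(1,2) 1 this]
  have eq2: "(fxx * x' t + fxy * y' t) * x' t + x'' t * a
      + ((fxy * x' t + fyy * y' t) * y' t + y'' t * b) = 0" by simp
  define l where "l = - x' t / b"
  have b0: "b \<noteq> 0" using fy by (simp add: b_def p_def)
  have xl: "x' t = - l * b" using b0 by (simp add: l_def)
  have yl: "y' t = l * a"
  proof -
    have "y' t * b = - (x' t) * a" using eq1 by (simp add: mult.commute add_eq_0_iff)
    then show ?thesis using nonzero_eq_divide_eq [OF b0, of "y' t" "- (x' t) * a"] by (simp add: l_def)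
  qed
  define H N where "H = fxx * b\<^sup>2 - 2 * fxy * a * b + fyy * a\<^sup>2" and "N = a\<^sup>2 + b\<^sup>2"
  have HN: "eval2 (bordered_hessian f) p = H" "eval2 (grad_sq f) p = N"
    by (simp_all add: bordered_hessian_def grad_sq_def H_def N_def a_def b_def fxx_def fxy_def
        fyy_def)
  have cross: "x' t * y'' t - x'' t * y' t = l ^ 3 * H"
  proof -
    have "x'' t * a + y'' t * b = - l\<^sup>2 * H"
      using eq2 unfolding xl yl H_def by (simp add: algebra_simps power2_eq_square)
    then have "- l * (x'' t * a + y'' t * b) = l ^ 3 * H"
      by (simp add: power3_eq_cube power2_eq_square)
    then show ?thesis unfolding xl yl by (simp add: algebra_simps)
  qed
  have lH: "l \<noteq> 0" "H \<noteq> 0" using c unfolding cross by auto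
  show "eval2 (bordered_hessian f) p \<noteq> 0" using lH by (simp add: HN)
  have sq: "(x' t)\<^sup>2 + (y' t)\<^sup>2 = l\<^sup>2 * N"
    unfolding xl yl N_def by (simp add: algebra_simps power2_eq_square)
  have red: "l * u * (l\<^sup>2 * N) / (l ^ 3 * H) = u * N / H" for u
    using lH by (simp add: power2_eq_square power3_eq_cube)
  show "x t - y' t * ((x' t)\<^sup>2 + (y' t)\<^sup>2) / (x' t * y'' t - x'' t * y' t)
      = x t - eval2 (dx f) p * eval2 (grad_sq f) p / eval2 (bordered_hessian f) p"
    unfolding sq cross HN unfolding yl red by (simp add: a_def)
  show "y t + x' t * ((x' t)\<^sup>2 + (y' t)\<^sup>2) / (x' t * y'' t - x'' t * y' t)
      = y t - eval2 (pderiv f) p * eval2 (grad_sq f) p / eval2 (bordered_hessian f) p"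
    using red [of b] unfolding sq cross HN unfolding xl by (simp add: b_def)
qed

text \<open>
  At points of the curve with \<open>f\<^sub>y \<noteq> 0\<close> the center of curvature is a rational function of the point, and
  \<open>algebraic_relation_on_curve\<close> yields the polynomial \<open>P\<close>. At the remaining points, in particular at
  singular ones, \<open>P\<close> vanishes by continuity: these points lie over the finitely many zeros of \<open>r\<close>, and an arc of
  nonzero curvature cannot stay over finitely many values of \<open>x\<close>.
\<close>

lemma evolute_algebraic:
  assumes lc: "lead_coeff f = 1" and fd: "deg_le (degree f) f" and d: "degree f > 0"
    and r: "r \<noteq> 0" "\<And>c y. poly r c \<noteq> 0 \<Longrightarrow> eval2 f (c, y) = 0 \<Longrightarrow> eval2 (pderiv f) (c, y) \<noteq> 0"
  shows "\<exists>P. P \<noteq> 0 \<and> P \<in> vanishing_ideal (evolute (zero_locus {f}))"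
proof -
  define H N where "H = bordered_hessian f" and "N = grad_sq f"
  obtain P where P: "P \<noteq> 0" and rel: "\<And>p. eval2 f p = 0 \<Longrightarrow> eval2 H p \<noteq> 0 \<Longrightarrow>
      eval2 P (eval2 ([:[:0, 1:]:] * H - dx f * N) p / eval2 H p,
               eval2 ([:0, 1:] * H - pderiv f * N) p / eval2 H p) = 0"
    using algebraic_relation_on_curve [OF lc fd d] by metis
  have "eval2 P z = 0" if "z \<in> evolute (zero_locus {f})" for z
  proof -
    from that obtain x y x' y' x'' y'' I t where I: "open I" "t \<in> I"
      and x: "C2_on I x x' x''" and y: "C2_on I y y' y''"
      and \<Gamma>: "\<forall>s\<in>I. (x s, y s) \<in> zero_locus {f}" and c: "x' t * y'' t - x'' t * y' t \<noteq> 0"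
      and z: "z = (x t - y' t * ((x' t)\<^sup>2 + (y' t)\<^sup>2) / (x' t * y'' t - x'' t * y' t),
                   y t + x' t * ((x' t)\<^sup>2 + (y' t)\<^sup>2) / (x' t * y'' t - x'' t * y' t))"
      unfolding evolute_def by blast
    have f: "\<forall>s\<in>I. eval2 f (x s, y s) = 0"
      using \<Gamma> by (simp add: zero_locus_def)
    define K where "K s = x' s * y'' s - x'' s * y' s" for s
    define E where "E s = eval2 P (x s - y' s * ((x' s)\<^sup>2 + (y' s)\<^sup>2) / K s,
                                   y s + x' s * ((x' s)\<^sup>2 + (y' s)\<^sup>2) / K s)" for s
    \<comment> \<open>\<open>E s\<close> is the value of \<open>P\<close> at the center of curvature; off the zeros of \<open>r\<close> it is zero by the choice of \<open>P\<close>.\<close>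
    have generic: "E s = 0" if s: "s \<in> I" "K s \<noteq> 0" "poly r (x s) \<noteq> 0" for s
    proof -
      have fy: "eval2 (pderiv f) (x s, y s) \<noteq> 0" using r(2) [OF s(3) bspec [OF f s(1)]] .
      note cc = center_of_curvature_implicit [OF I(1) s(1) x y f s(2) [unfolded K_def] fy,
          folded H_def N_def]
      show ?thesis
        using rel [OF bspec [OF f s(1)] cc(1)] cc(1) unfolding E_def K_def cc(2,3)
        by (simp add: diff_divide_distrib)
    qed
    have contx: "continuous_on I x" "continuous_on I x'" "continuous_on I x''"
      "continuous_on I y" "continuous_on I y'" "continuous_on I y''"
      using x y unfolding C2_on_def by (meson DERIV_isCont continuous_at_imp_continuous_on)+
    define J where "J = {s \<in> I. K s \<noteq> 0}"
    have K: "continuous_on I K" unfolding K_def [abs_def] by (intro continuous_intros contx)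
    have J: "open J" unfolding J_def
      using continuous_open_preimage [OF K I(1), of "- {0}"]
      by (auto simp: vimage_def Int_def)
    have P_cont: "continuous_on UNIV (eval2 P)"
      by (rule has_derivative_continuous_on [OF has_derivative_at_withinI [OF eval2_has_derivative]])
    have JI: "J \<subseteq> I" by (auto simp: J_def)
    have E: "continuous_on J E"
      unfolding E_def [abs_def]
    proof (rule continuous_on_compose2 [OF P_cont])
      note contJ = continuous_on_subset [OF _ JI]
      show "continuous_on J (\<lambda>s. (x s - y' s * ((x' s)\<^sup>2 + (y' s)\<^sup>2) / K s,
          y s + x' s * ((x' s)\<^sup>2 + (y' s)\<^sup>2) / K s))"
        by (intro continuous_intros contJ [OF contx(1)] contJ [OF contx(2)] contJ [OF contx(4)]
            contJ [OF contx(5)] contJ [OF K]) (auto simp: J_def)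
    qed simp
    have "E t = 0"
    proof (rule ccontr)
      assume nz: "E t \<noteq> 0"
      define W where "W = {s \<in> J. E s \<noteq> 0}"
      have "open W" unfolding W_def
        using continuous_open_preimage [OF E J, of "- {0}"]
        by (auto simp: vimage_def Int_def)
      moreover have "t \<in> W" using nz I(2) c by (simp add: W_def J_def K_def)
      ultimately obtain e where e: "e > 0" "ball t e \<subseteq> W"
        using open_contains_ball by blast
      have BI: "ball t e \<subseteq> I" using e by (auto simp: W_def J_def)
      have "poly r (x s) = 0" if "s \<in> ball t e" for s
      proof -
        have "s \<in> W" using that e(2) by blast
        then show ?thesis using generic [of s] by (auto simp: W_def J_def)
      qed
      then have "x ` ball t e \<subseteq> {c. poly r c = 0}" by auto
      then have "finite (x ` ball t e)"
        using poly_roots_finite [OF r(1)] finite_subset by blast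
      then have "x constant_on ball t e"
        using continuous_finite_range_constant [of "ball t e" x]
          continuous_on_subset [OF contx(1) BI] by simp
      then obtain k where k: "\<And>s. s \<in> ball t e \<Longrightarrow> x s = k"
        unfolding constant_on_def by blast
      have x'0: "x' s = 0" if s: "s \<in> ball t e" for s
      proof (rule deriv_zero_of_vanishing [OF open_ball s])
        show "((\<lambda>s. x s - k) has_real_derivative x' s) (at s)"
          using x BI s unfolding C2_on_def by (auto intro!: derivative_eq_intros)
      qed (simp add: k)
      have "x'' t = 0"
      proof (rule deriv_zero_of_vanishing [OF open_ball])
        show "t \<in> ball t e" using e(1) by simp
        show "(x' has_real_derivative x'' t) (at t)"
          using x I unfolding C2_on_def by blast
      qed (rule x'0)
      then show False using c x'0 e by simp
    qed
    then show ?thesis by (simp add: z E_def K_def)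
  qed
  with P show ?thesis by (auto simp: vanishing_ideal_def)
qed

section \<open>Centers of curvature near a node\<close>

lemma polynomial_function_derivative:
  fixes p :: "'a::real_normed_vector \<Rightarrow> real"
  assumes "real_polynomial_function p"
  shows "\<exists>D. (\<forall>z. (p has_derivative D z) (at z)) \<and> (\<forall>v. real_polynomial_function (\<lambda>z. D z v))"
  using assms
proof (induction p rule: real_polynomial_function.induct)
  case (linear f)
  then show ?case
    by (intro exI [of _ "\<lambda>_. f"])
       (auto intro: bounded_linear_imp_has_derivative)
next
  case (const c)
  then show ?case
    by (intro exI [of _ "\<lambda>_ _. 0"]) auto
next
  case (add f g)
  then obtain D E where DE: "\<forall>z. (f has_derivative D z) (at z)" "\<forall>v. real_polynomial_function (\<lambda>z. D z v)"
    "\<forall>z. (g has_derivative E z) (at z)" "\<forall>v. real_polynomial_function (\<lambda>z. E z v)" by blast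
  then show ?case
    by (intro exI [of _ "\<lambda>z v. D z v + E z v"])
       (auto intro: has_derivative_add)
next
  case (mult f g)
  then obtain D E where DE: "\<forall>z. (f has_derivative D z) (at z)" "\<forall>v. real_polynomial_function (\<lambda>z. D z v)"
    "\<forall>z. (g has_derivative E z) (at z)" "\<forall>v. real_polynomial_function (\<lambda>z. E z v)" by blast
  then show ?case
    using mult(1,2)
    by (intro exI [of _ "\<lambda>z v. f z * E z v + D z v * g z"])
       (auto intro!: has_derivative_mult real_polynomial_function.intros(3,4))
qed

text \<open>
  The first of the three variables serves as a parameter \<open>\<delta>\<close>; the partial derivatives with respect to the other two
  are again polynomial in all three variables, hence jointly continuous.
\<close>

lemma polynomial_function_partials:
  fixes p :: "real \<times> real \<times> real \<Rightarrow> real"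
  assumes "real_polynomial_function p"
  obtains ps pw where "real_polynomial_function ps" "real_polynomial_function pw"
    "\<And>\<delta> z. ((\<lambda>z. p (\<delta>, z)) has_derivative (\<lambda>h. ps (\<delta>, z) * fst h + pw (\<delta>, z) * snd h)) (at z)"
proof -
  obtain D where D: "\<And>z. (p has_derivative D z) (at z)"
    "\<And>v. real_polynomial_function (\<lambda>z. D z v)"
    using polynomial_function_derivative [OF assms] by blast
  show ?thesis
  proof (rule that [of "\<lambda>z. D z (0, 1, 0)" "\<lambda>z. D z (0, 0, 1)"])
    fix \<delta> :: real and z :: "real \<times> real"
    have lin: "linear (D (\<delta>, z))" using D(1) has_derivative_linear by blast
    have "D (\<delta>, z) (0, h) = D (\<delta>, z) (0, 1, 0) * fst h + D (\<delta>, z) (0, 0, 1) * snd h" for h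
    proof -
      have "D (\<delta>, z) (0, h) = D (\<delta>, z) (fst h *\<^sub>R (0, 1, 0) + snd h *\<^sub>R (0, 0, 1))"
        by (cases h) simp
      then show ?thesis by (simp only: linear_add [OF lin] linear_scale [OF lin]) (simp add: mult.commute)
    qed
    then have eq: "(\<lambda>h. D (\<delta>, z) (0, h))
        = (\<lambda>h. D (\<delta>, z) (0, 1, 0) * fst h + D (\<delta>, z) (0, 0, 1) * snd h)" by blast
    have "((\<lambda>z. (\<delta>, z)) has_derivative (\<lambda>h. (0, h))) (at z)"
      by (auto intro!: derivative_eq_intros)
    from has_derivative_compose [OF this D(1)]
    show "((\<lambda>z. p (\<delta>, z)) has_derivative
        (\<lambda>h. D (\<delta>, z) (0, 1, 0) * fst h + D (\<delta>, z) (0, 0, 1) * snd h)) (at z)"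
      unfolding eq .
  qed (rule D(2))+
qed

text \<open>
  The map \<open>(s, w) \<mapsto> (s, p (s, w))\<close> is locally invertible, and the inverse image of the axis is the graph of
  \<open>\<phi>\<close>. The functions \<open>W1\<close> and \<open>W2\<close> are what implicit differentiation gives for the first and second derivative
  of \<open>\<phi>\<close>; in this form they make sense as functions of the point, independently of \<open>\<phi>\<close>.
\<close>

lemma implicit_function_C2:
  fixes p ps pw pss psw pws pww W1 W2 :: "real \<times> real \<Rightarrow> real"
  assumes dp: "\<And>z. (p has_derivative (\<lambda>h. ps z * fst h + pw z * snd h)) (at z)"
    and dps: "\<And>z. (ps has_derivative (\<lambda>h. pss z * fst h + psw z * snd h)) (at z)"
    and dpw: "\<And>z. (pw has_derivative (\<lambda>h. pws z * fst h + pww z * snd h)) (at z)"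
    and cont: "continuous_on UNIV pss" "continuous_on UNIV psw"
      "continuous_on UNIV pws" "continuous_on UNIV pww"
    and p0: "p (s0, w0) = 0" and pw0: "pw (s0, w0) \<noteq> 0"
    and W1: "\<And>z. W1 z = - ps z / pw z"
    and W2: "\<And>z. W2 z = - ((pss z + psw z * W1 z) * pw z - ps z * (pws z + pww z * W1 z)) / (pw z)\<^sup>2"
  obtains I \<phi> where "open I" "connected I" "s0 \<in> I" "\<phi> s0 = w0"
    "\<And>s. s \<in> I \<Longrightarrow> p (s, \<phi> s) = 0"
    "C2_on I \<phi> (\<lambda>s. W1 (s, \<phi> s)) (\<lambda>s. W2 (s, \<phi> s))"
proof -
  have cont_p: "continuous_on UNIV ps" "continuous_on UNIV pw"
    by (rule has_derivative_continuous_on [OF has_derivative_at_withinI [OF dps]],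
        rule has_derivative_continuous_on [OF has_derivative_at_withinI [OF dpw]])
  define U where "U = {z. pw z \<noteq> 0}"
  have U: "open U"
    unfolding U_def by (intro open_Collect_neq cont_p continuous_on_const)
  define f where "f z = (fst z, p z)" for z
  define B0 B1 B2 :: "(real \<times> real) \<Rightarrow>\<^sub>L (real \<times> real)"
    where "B0 = Blinfun (\<lambda>h. (fst h, 0))" and "B1 = Blinfun (\<lambda>h. (0, fst h))"
      and "B2 = Blinfun (\<lambda>h. (0, snd h))"
  have B: "blinfun_apply B0 h = (fst h, 0)" "blinfun_apply B1 h = (0, fst h)"
    "blinfun_apply B2 h = (0, snd h)" for h
    unfolding B0_def B1_def B2_def
    by (subst bounded_linear_Blinfun_apply; auto intro!: bounded_linear_intros)+
  define f' where "f' z = B0 + ps z *\<^sub>R B1 + pw z *\<^sub>R B2" for z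
  have f'_apply: "blinfun_apply (f' z) h = (fst h, ps z * fst h + pw z * snd h)" for z h
    by (simp add: f'_def blinfun.add_left blinfun.scaleR_left B)
  have df: "(f has_derivative blinfun_apply (f' z)) (at z)" for z
    unfolding f_def
    by (rule has_derivative_eq_rhs [OF has_derivative_Pair [OF has_derivative_fst [OF has_derivative_ident] dp]])
       (simp add: f'_apply fun_eq_iff)
  have cont_f': "continuous_on U f'"
    unfolding f'_def by (intro continuous_intros continuous_on_subset [OF cont_p(1)]
        continuous_on_subset [OF cont_p(2)]) auto
  define z0 where "z0 = (s0, w0)"
  have z0: "z0 \<in> U" using pw0 by (simp add: U_def z0_def)
  define inv0 where "inv0 = Blinfun (\<lambda>h. (fst h, (snd h - ps z0 * fst h) / pw z0))"
  have "blinfun_apply inv0 h = (fst h, (snd h - ps z0 * fst h) / pw z0)" for h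
  proof -
    have "linear (\<lambda>h. (fst h, (snd h - ps z0 * fst h) / pw z0))"
      by (rule linearI) (auto simp: algebra_simps add_divide_distrib diff_divide_distrib)
    then show ?thesis
      unfolding inv0_def linear_conv_bounded_linear by (simp add: bounded_linear_Blinfun_apply)
  qed
  then have inv0: "inv0 o\<^sub>L f' z0 = id_blinfun"
    using pw0 by (intro blinfun_eqI) (simp add: f'_apply z0_def)
  obtain U' V g g' where UV: "open U'" "U' \<subseteq> U" "z0 \<in> U'" "open V" "f z0 \<in> V" "homeomorphism U' V f g"
    and dg: "\<And>y. y \<in> V \<Longrightarrow> (g has_derivative (g' y)) (at y)"
    by (rule inverse_function_theorem [OF U df cont_f' z0 inv0]) blast
  have fz0: "f z0 = (s0, 0)" by (simp add: f_def z0_def p0)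
  obtain e where e: "e > 0" "\<And>s. s \<in> ball s0 e \<Longrightarrow> (s, 0) \<in> V"
  proof -
    have "open ((\<lambda>s. (s, 0::real)) -` V)"
      by (intro open_vimage UV continuous_intros)
    moreover have "s0 \<in> (\<lambda>s. (s, 0::real)) -` V" using UV(5) by (simp add: fz0)
    ultimately show ?thesis using that unfolding open_contains_ball by blast
  qed
  define \<phi> where "\<phi> s = snd (g (s, 0))" for s
  have g: "g (s, 0) = (s, \<phi> s)" "p (s, \<phi> s) = 0" "pw (s, \<phi> s) \<noteq> 0" if s: "s \<in> ball s0 e" for s
  proof -
    have "f (g (s, 0)) = (s, 0)" "g (s, 0) \<in> U"
      using UV(2,6) e(2) [OF s] unfolding homeomorphism_def by auto
    then show "g (s, 0) = (s, \<phi> s)" "p (s, \<phi> s) = 0" "pw (s, \<phi> s) \<noteq> 0"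
      by (cases "g (s, 0)"; simp add: f_def \<phi>_def U_def)+
  qed
  have \<phi>0: "\<phi> s0 = w0"
    using UV(3,6) unfolding homeomorphism_def \<phi>_def by (metis fz0 snd_conv z0_def)
  have chain: "((\<lambda>s. q (s, \<phi> s)) has_real_derivative qs + qw * y) (at s)"
    if "(q has_derivative (\<lambda>h. qs * fst h + qw * snd h)) (at (s, \<phi> s))"
      "(\<phi> has_real_derivative y) (at s)" for q qs qw y s
  proof -
    have "((\<lambda>s. (s, \<phi> s)) has_derivative (\<lambda>h. (h, y * h))) (at s)"
      using that(2) unfolding has_field_derivative_def
      by (intro has_derivative_Pair has_derivative_ident)
    from has_derivative_compose [OF this that(1)] show ?thesis
      unfolding has_field_derivative_def
      by (rule has_derivative_eq_rhs) (simp add: fun_eq_iff algebra_simps)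
  qed
  have d\<phi>: "(\<phi> has_real_derivative W1 (s, \<phi> s)) (at s)" if s: "s \<in> ball s0 e" for s
  proof -
    have "((\<lambda>s. (s, 0::real)) has_derivative (\<lambda>h. (h, 0))) (at s)"
      by (auto intro!: derivative_eq_intros)
    from has_derivative_snd [OF has_derivative_compose [OF this dg [OF e(2) [OF s]]]]
    have "\<phi> differentiable at s" unfolding \<phi>_def by (rule differentiableI)
    then obtain y where y: "(\<phi> has_real_derivative y) (at s)"
      using real_differentiable_def by blast
    have "((\<lambda>s. p (s, \<phi> s)) has_real_derivative ps (s, \<phi> s) + pw (s, \<phi> s) * y) (at s)"
      by (rule chain [OF dp y])
    moreover have "((\<lambda>s. p (s, \<phi> s)) has_real_derivative 0) (at s)"
      by (rule has_field_derivative_transform_within_open [OF DERIV_const open_ball s])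
         (simp add: g)
    ultimately have "ps (s, \<phi> s) + pw (s, \<phi> s) * y = 0" by (rule DERIV_unique)
    then have "y * pw (s, \<phi> s) = - ps (s, \<phi> s)"
      by (simp add: mult.commute add_eq_0_iff)
    then have "y = W1 (s, \<phi> s)"
      unfolding W1 by (rule iffD2 [OF nonzero_eq_divide_eq [OF g(3) [OF s]]])
    with y show ?thesis by simp
  qed
  have "C2_on (ball s0 e) \<phi> (\<lambda>s. W1 (s, \<phi> s)) (\<lambda>s. W2 (s, \<phi> s))"
    unfolding C2_on_def
  proof (intro conjI ballI)
    fix s assume s: "s \<in> ball s0 e"
    show "(\<phi> has_real_derivative W1 (s, \<phi> s)) (at s)" by (rule d\<phi> [OF s])
    have "((\<lambda>s. - ps (s, \<phi> s) / pw (s, \<phi> s)) has_real_derivative W2 (s, \<phi> s)) (at s)"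
      by (rule derivative_eq_intros chain [OF dps d\<phi> [OF s]] chain [OF dpw d\<phi> [OF s]] g(3) [OF s] refl)+
         (simp add: W2 power2_eq_square algebra_simps)
    then show "((\<lambda>s. W1 (s, \<phi> s)) has_real_derivative W2 (s, \<phi> s)) (at s)"
      by (simp add: W1)
  next
    have c: "continuous_on (ball s0 e) (\<lambda>s. (s, \<phi> s))"
      by (intro continuous_intros DERIV_continuous_on [OF has_field_derivative_at_within [OF d\<phi>]])
    show "continuous_on (ball s0 e) (\<lambda>s. W2 (s, \<phi> s))"
      unfolding W2 W1
      by (intro continuous_intros continuous_on_compose2 [OF cont(1) c] continuous_on_compose2 [OF cont(2) c]
          continuous_on_compose2 [OF cont(3) c] continuous_on_compose2 [OF cont(4) c]
          continuous_on_compose2 [OF cont_p(1) c] continuous_on_compose2 [OF cont_p(2) c])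
         (auto simp: g(3))
  qed
  with e(1) \<phi>0 g(2) show ?thesis
    by (intro that [of "ball s0 e" \<phi>]) auto
qed

lemma partials_unique:
  fixes p :: "real \<times> real \<times> real \<Rightarrow> real"
  assumes "((\<lambda>z. p (0, z)) has_derivative (\<lambda>h. u * fst h + v * snd h)) (at z)"
    and "\<And>z. p (0, z) = q z" "(q has_derivative q') (at z)"
  shows "u = q' (1, 0)" "v = q' (0, 1)"
proof -
  have "(q has_derivative (\<lambda>h. u * fst h + v * snd h)) (at z)"
    using assms(1,2) by simp
  then have eq: "(\<lambda>h. u * fst h + v * snd h) = q'"
    using assms(3) has_derivative_unique by blast
  show "u = q' (1, 0)" "v = q' (0, 1)"
    unfolding eq [symmetric] by simp_all
qed

text \<open>
  Here \<open>(a, b)\<close> is a node, \<open>m\<close> the slope of one of the lines through it, and \<open>F = 0\<close> the equation of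
  the smoothed curve in the coordinates \<open>x = a + \<delta> s\<close>, \<open>y = b + m \<delta> s + \<delta>\<^sup>2 w\<close>. The conclusion says that
  a branch \<open>w = \<phi> s\<close> has a center of curvature on the line \<open>x = C\<close>, near the point where this line meets the
  normal at the node.

  On the curve \<open>F = 0\<close> the derivatives of \<open>\<phi>\<close>, and with them the coordinates \<open>X\<close> and \<open>Y\<close> of the center, are
  rational functions of \<open>(\<delta>, s, w)\<close>. For \<open>\<delta> = 0\<close> the curve is \<open>w = 1 / (\<kappa> s)\<close> and the center is
  \<open>(a - m (1 + m\<^sup>2) / w'', b + (1 + m\<^sup>2) / w'')\<close> with \<open>1 / w'' = \<kappa> s\<^sup>3 / 2\<close>. This runs through the
  normal without the node, so some \<open>z0 = (0, s0, w0)\<close> has \<open>F = 0\<close> and \<open>X = C0\<close>. The derivative of \<open>(\<delta>, F, X)\<close> at \<open>z0\<close> is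
  invertible; hence the values of this map near \<open>z0\<close> cover all \<open>(\<delta>, 0, C)\<close> close to \<open>(0, 0, C0)\<close>.
\<close>

lemma nodal_branch_centers:
  fixes F :: "real \<times> real \<times> real \<Rightarrow> real"
  assumes F: "real_polynomial_function F" and F0: "\<And>s w. F (0, s, w) = \<kappa> * s * w - 1"
    and nz: "\<kappa> \<noteq> 0" "m \<noteq> 0" "a \<noteq> C0" and \<sigma>: "\<sigma> > 0"
  shows "\<exists>\<eta>>0. \<forall>\<delta> C. 0 < \<delta> \<longrightarrow> \<delta> < \<eta> \<longrightarrow> \<bar>C - C0\<bar> < \<eta> \<longrightarrow>
    (\<exists>I \<phi> \<phi>' \<phi>'' s. open I \<and> connected I \<and> s \<in> I \<and> C2_on I \<phi> \<phi>' \<phi>'' \<and>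
      (\<forall>t\<in>I. F (\<delta>, t, \<phi> t) = 0) \<and> \<phi>'' s \<noteq> 0 \<and>
      a + \<delta> * s - (m + \<delta> * \<phi>' s) * (1 + (m + \<delta> * \<phi>' s)\<^sup>2) / \<phi>'' s = C \<and>
      \<bar>b + m * (\<delta> * s) + \<delta>\<^sup>2 * \<phi> s + (1 + (m + \<delta> * \<phi>' s)\<^sup>2) / \<phi>'' s
         - (b + (a - C0) / m)\<bar> < \<sigma>)"
proof -
  obtain Fs Fw where P1: "real_polynomial_function Fs" "real_polynomial_function Fw"
    and dF: "\<And>\<delta> z. ((\<lambda>z. F (\<delta>, z)) has_derivative (\<lambda>h. Fs (\<delta>, z) * fst h + Fw (\<delta>, z) * snd h)) (at z)"
    by (rule polynomial_function_partials [OF F]) blast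
  obtain Fss Fsw where P2: "real_polynomial_function Fss" "real_polynomial_function Fsw"
    and dFs: "\<And>\<delta> z. ((\<lambda>z. Fs (\<delta>, z)) has_derivative (\<lambda>h. Fss (\<delta>, z) * fst h + Fsw (\<delta>, z) * snd h)) (at z)"
    by (rule polynomial_function_partials [OF P1(1)]) blast
  obtain Fws Fww where P3: "real_polynomial_function Fws" "real_polynomial_function Fww"
    and dFw: "\<And>\<delta> z. ((\<lambda>z. Fw (\<delta>, z)) has_derivative (\<lambda>h. Fws (\<delta>, z) * fst h + Fww (\<delta>, z) * snd h)) (at z)"
    by (rule polynomial_function_partials [OF P1(2)]) blast
  have cont: "continuous_on A p" if "real_polynomial_function p"
    for A and p :: "real \<times> real \<times> real \<Rightarrow> real"
    using continuous_real_polymonial_function [OF that] continuous_at_imp_continuous_on by blast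
  define W1 W2 where "W1 z = - Fs z / Fw z"
    and "W2 z = - ((Fss z + Fsw z * W1 z) * Fw z - Fs z * (Fws z + Fww z * W1 z)) / (Fw z)\<^sup>2" for z
  define X where "X z = a + fst z * fst (snd z)
      - (m + fst z * W1 z) * (1 + (m + fst z * W1 z)\<^sup>2) / W2 z" for z
  define Y where "Y z = b + m * (fst z * fst (snd z)) + (fst z)\<^sup>2 * snd (snd z)
      + (1 + (m + fst z * W1 z)\<^sup>2) / W2 z" for z
  \<comment> \<open>On the plane \<open>\<delta> = 0\<close> everything is explicit, since \<open>F\<close> is \<open>\<kappa> s w - 1\<close> there.\<close>
  have Fs0: "Fs (0, z) = \<kappa> * snd z" and Fw0: "Fw (0, z) = \<kappa> * fst z" for z
  proof -
    have eq: "F (0, z) = \<kappa> * fst z * snd z - 1" for z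
      using F0 [of "fst z" "snd z"] by simp
    have "((\<lambda>z. \<kappa> * fst z * snd z - 1) has_derivative
        (\<lambda>h. \<kappa> * fst z * snd h + \<kappa> * fst h * snd z)) (at z)"
      by (auto intro!: derivative_eq_intros)
    from partials_unique [OF dF eq this]
    show "Fs (0, z) = \<kappa> * snd z" "Fw (0, z) = \<kappa> * fst z" by simp_all
  qed
  have d2: "Fss (0, z) = 0" "Fsw (0, z) = \<kappa>" "Fws (0, z) = \<kappa>" "Fww (0, z) = 0" for z
  proof -
    have "((\<lambda>z. \<kappa> * snd z) has_derivative (\<lambda>h. \<kappa> * snd h)) (at z)"
      "((\<lambda>z. \<kappa> * fst z) has_derivative (\<lambda>h. \<kappa> * fst h)) (at z)"
      by (auto intro!: derivative_eq_intros)
    from partials_unique [OF dFs Fs0 this(1)] partials_unique [OF dFw Fw0 this(2)]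
    show "Fss (0, z) = 0" "Fsw (0, z) = \<kappa>" "Fws (0, z) = \<kappa>" "Fww (0, z) = 0" by simp_all
  qed
  have W20: "W2 (0, z) = 2 * snd z / (fst z)\<^sup>2" if "fst z \<noteq> 0" for z
    using that nz unfolding W2_def W1_def Fs0 Fw0 d2 by (simp add: field_simps power2_eq_square)
  \<comment> \<open>The center at \<open>(0, s, w)\<close> has abscissa \<open>C0\<close> iff \<open>1 / W2 = \<rho>\<close>; on the hyperbola \<open>\<kappa> s w = 1\<close> this is a cubic equation for \<open>s\<close>.\<close>
  define \<rho> s0 w0 where "\<rho> = (a - C0) / (m * (1 + m\<^sup>2))" and "s0 = root 3 (2 * \<rho> / \<kappa>)"
    and "w0 = 1 / (\<kappa> * s0)"
  have m2: "1 + m\<^sup>2 \<noteq> 0" by (metis add_pos_nonneg less_irrefl zero_le_power2 zero_less_one)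
  have \<rho>: "\<rho> \<noteq> 0" using nz m2 by (simp add: \<rho>_def)
  have s03: "s0 ^ 3 = 2 * \<rho> / \<kappa>" by (simp add: s0_def odd_real_root_pow)
  have s0: "s0 \<noteq> 0" using s03 \<rho> nz by auto
  have w0: "w0 \<noteq> 0" using s0 nz by (simp add: w0_def)
  define z0 where "z0 = (0::real, s0, w0)"
  have "1 / W2 z0 = s0 ^ 3 * \<kappa> / 2"
    unfolding z0_def using s0 nz by (simp add: W20 w0_def power2_eq_square power3_eq_cube)
  then have W2z0: "1 / W2 z0 = \<rho>" using nz by (simp add: s03)
  then have W2z0': "W2 z0 \<noteq> 0" using \<rho> by auto
  have Fz0: "F z0 = 0" unfolding z0_def using F0 s0 nz by (simp add: w0_def)
  have Fwz0: "Fw z0 \<noteq> 0" unfolding z0_def using Fw0 s0 nz by simp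
  have Xz0: "X z0 = C0"
  proof -
    have "X z0 = a - m * (1 + m\<^sup>2) * (1 / W2 z0)" by (simp add: X_def z0_def)
    also have "\<dots> = C0" unfolding W2z0 \<rho>_def using nz m2 by simp
    finally show ?thesis .
  qed
  have Yz0: "Y z0 = b + (a - C0) / m"
  proof -
    have "Y z0 = b + (1 + m\<^sup>2) * (1 / W2 z0)" by (simp add: Y_def z0_def)
    also have "\<dots> = b + (a - C0) / m" unfolding W2z0 \<rho>_def using nz m2 by simp
    finally show ?thesis .
  qed
  define S0 where "S0 = {z. Fw z \<noteq> 0}"
  have S0: "open S0" unfolding S0_def by (intro open_Collect_neq cont P1 continuous_on_const)
  have cW1: "continuous_on S0 W1"
    unfolding W1_def [abs_def] by (intro continuous_intros cont P1) (auto simp: S0_def)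
  have cW2: "continuous_on S0 W2"
    unfolding W2_def [abs_def] by (intro continuous_intros cont cW1 P1 P2 P3) (auto simp: S0_def)
  define S where "S = S0 \<inter> W2 -` (- {0})"
  have S: "open S" unfolding S_def by (rule continuous_open_preimage [OF cW2 S0]) (rule open_Compl [OF closed_singleton])
  have SS0: "S \<subseteq> S0" by (auto simp: S_def)
  have cX: "continuous_on S X" and cY: "continuous_on S Y"
    unfolding X_def [abs_def] Y_def [abs_def]
    by (intro continuous_intros continuous_on_subset [OF cW1 SS0] continuous_on_subset [OF cW2 SS0];
        auto simp: S_def)+
  define N where "N = S \<inter> (\<lambda>z. \<bar>Y z - Y z0\<bar>) -` {..<\<sigma>}"
  have N: "open N" unfolding N_def
    by (rule continuous_open_preimage [OF _ S]) (intro continuous_intros cY, simp)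
  have z0S: "z0 \<in> S" "z0 \<in> N" using Fwz0 W2z0' \<sigma> by (auto simp: S_def S0_def N_def)
  define \<Phi> where "\<Phi> z = (fst z, F z, X z)" for z
  have c\<Phi>: "continuous_on S \<Phi>"
    unfolding \<Phi>_def [abs_def] by (intro continuous_intros cX cont F)
  obtain F' where F': "(F has_derivative F') (at z0)"
    using differentiable_at_real_polynomial_function [OF F] unfolding differentiable_def by blast
  have "X differentiable at z0"
  proof -
    have dp: "p differentiable at z0" if "real_polynomial_function p" for p
      using differentiable_at_real_polynomial_function [OF that] .
    have dW1: "W1 differentiable at z0"
      unfolding W1_def [abs_def] using Fwz0 by (intro derivative_intros dp P1)
    have dW2: "W2 differentiable at z0"
      unfolding W2_def [abs_def] using Fwz0 by (intro derivative_intros dp P1 P2 P3 dW1) auto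
    have "(fst :: real \<times> real \<times> real \<Rightarrow> real) differentiable at z0"
      "(\<lambda>z::real \<times> real \<times> real. fst (snd z)) differentiable at z0"
      by (auto intro!: bounded_linear_imp_differentiable bounded_linear_intros)
    then show ?thesis
      unfolding X_def [abs_def] using W2z0' by (intro derivative_intros dW1 dW2)
  qed
  then obtain X' where X': "(X has_derivative X') (at z0)"
    unfolding differentiable_def by blast
  define \<Phi>' where "\<Phi>' h = (fst h, F' h, X' h)" for h
  have d\<Phi>: "(\<Phi> has_derivative \<Phi>') (at z0)"
    unfolding \<Phi>_def [abs_def] \<Phi>'_def [abs_def]
    by (intro has_derivative_Pair F' X' has_derivative_fst has_derivative_ident)
  have lin: "linear \<Phi>'" using d\<Phi> has_derivative_linear by blast
  \<comment> \<open>For the kernel of \<open>\<Phi>'\<close> only vectors with vanishing first component matter, so it is enough to know \<open>F\<close> and \<open>X\<close> on the plane \<open>\<delta> = 0\<close>.\<close>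
  have emb: "((\<lambda>z. (0::real, z)) has_derivative (\<lambda>h. (0, h))) (at (s0, w0))"
    by (auto intro!: derivative_eq_intros)
  have F'0: "F' (0, h) = \<kappa> * w0 * fst h + \<kappa> * s0 * snd h" for h
  proof -
    have "((\<lambda>z. F (0, z)) has_derivative (\<lambda>h. F' (0, h))) (at (s0, w0))"
      using has_derivative_compose [OF emb, of F F'] F' by (simp add: z0_def)
    from has_derivative_unique [OF this dF] show ?thesis
      by (cases h) (simp add: fun_eq_iff Fs0 Fw0)
  qed
  have X'0: "X' (0, h) = - m * (1 + m\<^sup>2) * (s0 / w0 * fst h - s0\<^sup>2 / (2 * w0\<^sup>2) * snd h)" for h
  proof -
    define q where "q z = a - m * (1 + m\<^sup>2) * ((fst z)\<^sup>2 / (2 * snd z))" for z :: "real \<times> real"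
    have 1: "((\<lambda>z. X (0, z)) has_derivative (\<lambda>h. X' (0, h))) (at (s0, w0))"
      using has_derivative_compose [OF emb, of X X'] X' by (simp add: z0_def)
    have o: "open {z::real \<times> real. fst z \<noteq> 0}"
      by (intro open_Collect_neq continuous_intros)
    have 2: "(q has_derivative (\<lambda>h. X' (0, h))) (at (s0, w0))"
      by (rule has_derivative_transform_within_open [OF 1 o])
         (use s0 in \<open>auto simp: X_def W20 q_def\<close>)
    have 3: "(q has_derivative
        (\<lambda>h. - m * (1 + m\<^sup>2) * (s0 / w0 * fst h - s0\<^sup>2 / (2 * w0\<^sup>2) * snd h))) (at (s0, w0))"
      unfolding q_def [abs_def] using w0
      by (auto intro!: derivative_eq_intros simp: fun_eq_iff field_simps power2_eq_square)
    show ?thesis using has_derivative_unique [OF 2 3] by (rule fun_cong)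
  qed
  have "inj \<Phi>'"
  proof (subst linear_injective_0 [OF lin], intro allI impI)
    fix h :: "real \<times> real \<times> real" assume h: "\<Phi>' h = 0"
    obtain k l where kl: "h = (0, k, l)" using h by (cases h) (auto simp: \<Phi>'_def zero_prod_def)
    have "\<kappa> * w0 * k + \<kappa> * s0 * l = 0" using h by (simp add: kl \<Phi>'_def F'0 zero_prod_def)
    then have "\<kappa> * (w0 * k + s0 * l) = 0" by (simp add: algebra_simps)
    then have 1: "w0 * k = - s0 * l" using nz by (simp add: add_eq_0_iff2)
    have "s0 / w0 * k - s0\<^sup>2 / (2 * w0\<^sup>2) * l = 0"
      using h nz m2 by (simp add: kl \<Phi>'_def X'0 zero_prod_def)
    then have "2 * s0 * (w0 * k) - s0\<^sup>2 * l = 0"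
      using w0 by (simp add: field_simps power2_eq_square)
    then have "3 * s0\<^sup>2 * l = 0" unfolding 1 by (auto simp: power2_eq_square)
    then have "l = 0" using s0 by simp
    with 1 w0 show "h = 0" by (simp add: kl zero_prod_def)
  qed
  then have "surj \<Phi>'" using lin linear_injective_imp_surjective by blast
  then obtain G where G: "linear G" "\<Phi>' \<circ> G = id"
    using linear_surjective_right_inverse [OF lin] by blast
  have "\<Phi> z0 \<in> interior (\<Phi> ` N)"
  proof (rule sussmann_open_mapping [OF S c\<Phi> z0S(1) d\<Phi> _ G(2)])
    show "bounded_linear G" using G(1) by (simp add: linear_conv_bounded_linear)
    show "z0 \<in> interior N" using z0S(2) by (simp only: interior_open [OF N])
  qed (simp add: N_def)
  moreover have "\<Phi> z0 = (0, 0, C0)" by (simp add: \<Phi>_def z0_def Fz0 [unfolded z0_def] Xz0 [unfolded z0_def])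
  ultimately obtain e where e: "e > 0" "ball (0, 0, C0) e \<subseteq> \<Phi> ` N"
    unfolding mem_interior by auto
  show ?thesis
  proof (intro exI [of _ "e / 2"] conjI allI impI)
    show "e / 2 > 0" using e by simp
    fix \<delta> C assume \<delta>: "0 < \<delta>" "\<delta> < e / 2" and C: "\<bar>C - C0\<bar> < e / 2"
    have "dist (0, 0::real, C0) (\<delta>, 0, C) = sqrt (\<delta>\<^sup>2 + (C - C0)\<^sup>2)"
      by (simp add: dist_Pair_Pair dist_real_def power2_commute)
    also have "\<dots> \<le> \<bar>\<delta>\<bar> + \<bar>C - C0\<bar>" by (rule sqrt_sum_squares_le_sum_abs)
    finally have "dist (0, 0::real, C0) (\<delta>, 0, C) < e" using \<delta> C by linarith
    then have "(\<delta>, 0::real, C) \<in> ball (0, 0, C0) e" unfolding mem_ball .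
    with e(2) obtain z where z: "z \<in> N" "\<Phi> z = (\<delta>, 0, C)" by (metis imageE subsetD)
    then obtain s w where sw: "z = (\<delta>, s, w)" by (cases z) (auto simp: \<Phi>_def)
    have zz: "F (\<delta>, s, w) = 0" "X (\<delta>, s, w) = C" "Fw (\<delta>, s, w) \<noteq> 0" "W2 (\<delta>, s, w) \<noteq> 0"
      "\<bar>Y (\<delta>, s, w) - Y z0\<bar> < \<sigma>"
      using z by (auto simp: sw \<Phi>_def N_def S_def S0_def)
    have cp: "continuous_on UNIV (\<lambda>z. p (\<delta>, z))" if "real_polynomial_function p"
      for p :: "real \<times> real \<times> real \<Rightarrow> real"
      by (rule continuous_on_compose2 [OF cont [OF that, of UNIV]]) (auto intro: continuous_intros)
    obtain I \<phi> where I: "open I" "connected I" "s \<in> I" "\<phi> s = w"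
      "\<And>t. t \<in> I \<Longrightarrow> F (\<delta>, t, \<phi> t) = 0"
      "C2_on I \<phi> (\<lambda>t. W1 (\<delta>, t, \<phi> t)) (\<lambda>t. W2 (\<delta>, t, \<phi> t))"
      by (rule implicit_function_C2 [OF dF [of \<delta>] dFs [of \<delta>] dFw [of \<delta>]
            cp [OF P2(1)] cp [OF P2(2)] cp [OF P3(1)] cp [OF P3(2)] zz(1) zz(3),
            of "\<lambda>z. W1 (\<delta>, z)" "\<lambda>z. W2 (\<delta>, z)"]) (auto simp: W1_def W2_def)
    show "\<exists>I \<phi> \<phi>' \<phi>'' s. open I \<and> connected I \<and> s \<in> I \<and> C2_on I \<phi> \<phi>' \<phi>'' \<and>
      (\<forall>t\<in>I. F (\<delta>, t, \<phi> t) = 0) \<and> \<phi>'' s \<noteq> 0 \<and>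
      a + \<delta> * s - (m + \<delta> * \<phi>' s) * (1 + (m + \<delta> * \<phi>' s)\<^sup>2) / \<phi>'' s = C \<and>
      \<bar>b + m * (\<delta> * s) + \<delta>\<^sup>2 * \<phi> s + (1 + (m + \<delta> * \<phi>' s)\<^sup>2) / \<phi>'' s
         - (b + (a - C0) / m)\<bar> < \<sigma>"
      using I zz
      by (intro exI [of _ I] exI [of _ \<phi>] exI [of _ "\<lambda>t. W1 (\<delta>, t, \<phi> t)"]
          exI [of _ "\<lambda>t. W2 (\<delta>, t, \<phi> t)"] exI [of _ s])
         (simp add: X_def Y_def flip: Yz0)
  qed
qed

text \<open>
  In the coordinates adapted to line \<open>i\<close> at its node with line \<open>j\<close>, the factor of line \<open>i\<close> is \<open>\<delta>\<^sup>2 w\<close>, that of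
  line \<open>j\<close> is divisible by \<open>\<delta>\<close>, and the other lines do not pass through the node. This is why
  \<open>\<delta>\<^sup>3\<close> is the right size of the perturbation.
\<close>

lemma smoothed_lines_rescaled:
  assumes ij: "i \<in> {1..d}" "j \<in> {1..d}" "i \<noteq> j"
  shows "eval2 (smoothed_lines d (\<delta> ^ 3))
      (real i + real j + \<delta> * s, real i * (real i + real j + \<delta> * s) - (real i)\<^sup>2 + \<delta>\<^sup>2 * w)
    = \<delta> ^ 3 * (w * ((real i - real j) * s + \<delta> * w) *
        (\<Prod>k\<in>{1..d} - {i, j}. (real i - real k) * (real j - real k + \<delta> * s) + \<delta>\<^sup>2 * w) - 1)"
proof -
  define x where "x = real i + real j + \<delta> * s"
  define t where "t k = real i * x - (real i)\<^sup>2 + \<delta>\<^sup>2 * w - real k * x + (real k)\<^sup>2" for k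
  have t: "t k = (real i - real k) * (real j - real k + \<delta> * s) + \<delta>\<^sup>2 * w" for k
    by (simp add: t_def x_def algebra_simps power2_eq_square)
  have "{1..d} = insert i (insert j ({1..d} - {i, j}))" using ij by auto
  then have "(\<Prod>k=1..d. t k) = (\<Prod>k\<in>insert i (insert j ({1..d} - {i, j})). t k)" by simp
  also have "\<dots> = t i * (t j * (\<Prod>k\<in>{1..d} - {i, j}. t k))" using ij(3) by simp
  also have "t i * (t j * (\<Prod>k\<in>{1..d} - {i, j}. t k))
      = \<delta> ^ 3 * (w * ((real i - real j) * s + \<delta> * w) * (\<Prod>k\<in>{1..d} - {i, j}. t k))"
    unfolding t [of i] t [of j] by (simp add: algebra_simps power2_eq_square power3_eq_cube)
  finally have "eval2 (smoothed_lines d (\<delta> ^ 3)) (x, real i * x - (real i)\<^sup>2 + \<delta>\<^sup>2 * w)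
      = \<delta> ^ 3 * (w * ((real i - real j) * s + \<delta> * w) * (\<Prod>k\<in>{1..d} - {i, j}. t k)) - \<delta> ^ 3"
    unfolding eval2_smoothed_lines t_def by simp
  then show ?thesis unfolding x_def [symmetric] t by (simp add: right_diff_distrib)
qed

text \<open>
  The line \<open>x = C0\<close> meets the normal of line \<open>i\<close> at the node \<open>(i + j, i j)\<close> in the height
  \<open>i j + (i + j - C0) / i\<close>.
\<close>

lemma evolute_near_node_normal:
  assumes ij: "i \<in> {1..d}" "j \<in> {1..d}" "i \<noteq> j" and C0: "C0 \<noteq> real i + real j" and \<sigma>: "\<sigma> > 0"
  shows "\<exists>\<eta>>0. \<forall>\<delta> C. 0 < \<delta> \<longrightarrow> \<delta> < \<eta> \<longrightarrow> \<bar>C - C0\<bar> < \<eta> \<longrightarrow>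
    (\<exists>Y. (C, Y) \<in> evolute (zero_locus {smoothed_lines d (\<delta> ^ 3)}) \<and>
       \<bar>Y - (real i * real j + (real i + real j - C0) / real i)\<bar> < \<sigma>)"
proof -
  define K where "K = {1..d} - {i, j}"
  define F where "F z = snd (snd z) * ((real i - real j) * fst (snd z) + fst z * snd (snd z)) *
      (\<Prod>k\<in>K. (real i - real k) * (real j - real k + fst z * fst (snd z)) + (fst z * fst z) * snd (snd z)) - 1"
    for z :: "real \<times> real \<times> real"
  define \<kappa> where "\<kappa> = (real i - real j) * (\<Prod>k\<in>K. (real i - real k) * (real j - real k))"
  have "real_polynomial_function F"
  proof -
    note rpf = real_polynomial_function.intros
    have lin: "real_polynomial_function (\<lambda>z::real \<times> real \<times> real. fst z)"
      "real_polynomial_function (\<lambda>z::real \<times> real \<times> real. fst (snd z))"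
      "real_polynomial_function (\<lambda>z::real \<times> real \<times> real. snd (snd z))"
      by (rule rpf(1), intro bounded_linear_intros)+
    have K: "finite K" by (simp add: K_def)
    show ?thesis
      unfolding F_def [abs_def]
      by (intro real_polynomial_function_diff real_polynomial_function_prod [OF K] rpf(2-4) lin)
  qed
  moreover have "F (0, s, w) = \<kappa> * s * w - 1" for s w
    by (simp add: F_def \<kappa>_def)
  moreover have "\<kappa> \<noteq> 0" using ij by (simp add: \<kappa>_def K_def)
  moreover have "real i \<noteq> 0" using ij by simp
  ultimately obtain \<eta> where \<eta>: "\<eta> > 0" and branch: "\<And>\<delta> C. 0 < \<delta> \<Longrightarrow> \<delta> < \<eta> \<Longrightarrow> \<bar>C - C0\<bar> < \<eta> \<Longrightarrow>
    (\<exists>I \<phi> \<phi>' \<phi>'' s. open I \<and> connected I \<and> s \<in> I \<and> C2_on I \<phi> \<phi>' \<phi>'' \<and>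
      (\<forall>t\<in>I. F (\<delta>, t, \<phi> t) = 0) \<and> \<phi>'' s \<noteq> 0 \<and>
      real i + real j + \<delta> * s - (real i + \<delta> * \<phi>' s) * (1 + (real i + \<delta> * \<phi>' s)\<^sup>2) / \<phi>'' s = C \<and>
      \<bar>real i * real j + real i * (\<delta> * s) + \<delta>\<^sup>2 * \<phi> s + (1 + (real i + \<delta> * \<phi>' s)\<^sup>2) / \<phi>'' s
         - (real i * real j + (real i + real j - C0) / real i)\<bar> < \<sigma>)"
    using nodal_branch_centers [of F \<kappa> "real i" "real i + real j" C0 \<sigma> "real i * real j"] C0 \<sigma>
    by metis
  show ?thesis
  proof (rule exI [of _ \<eta>], intro conjI allI impI)
    fix \<delta> C assume \<delta>: "0 < \<delta>" "\<delta> < \<eta>" and C: "\<bar>C - C0\<bar> < \<eta>"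
    obtain I \<phi> \<phi>' \<phi>'' s where I: "open I" "connected I" "s \<in> I" and \<phi>: "C2_on I \<phi> \<phi>' \<phi>''"
      and F0: "\<And>t. t \<in> I \<Longrightarrow> F (\<delta>, t, \<phi> t) = 0" and nz: "\<phi>'' s \<noteq> 0"
      and X: "real i + real j + \<delta> * s
        - (real i + \<delta> * \<phi>' s) * (1 + (real i + \<delta> * \<phi>' s)\<^sup>2) / \<phi>'' s = C"
      and Y: "\<bar>real i * real j + real i * (\<delta> * s) + \<delta>\<^sup>2 * \<phi> s
         + (1 + (real i + \<delta> * \<phi>' s)\<^sup>2) / \<phi>'' s
         - (real i * real j + (real i + real j - C0) / real i)\<bar> < \<sigma>"
      using branch [OF \<delta> C] by blast
    define x y x' y' x'' y'' where "x t = real i + real j + \<delta> * t"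
      and "y t = real i * (real i + real j + \<delta> * t) - (real i)\<^sup>2 + \<delta>\<^sup>2 * \<phi> t"
      and "x' t = \<delta>" and "y' t = real i * \<delta> + \<delta>\<^sup>2 * \<phi>' t"
      and "x'' t = (0::real)" and "y'' t = \<delta>\<^sup>2 * \<phi>'' t" for t
    have x: "C2_on I x x' x''"
      unfolding C2_on_def x_def [abs_def] x'_def [abs_def] x''_def [abs_def]
      by (auto intro!: derivative_eq_intros)
    have y: "C2_on I y y' y''"
      using \<phi> unfolding C2_on_def y_def [abs_def] y'_def [abs_def] y''_def [abs_def]
      by (auto intro!: derivative_eq_intros continuous_intros)
    have on_curve: "(x t, y t) \<in> zero_locus {smoothed_lines d (\<delta> ^ 3)}" if "t \<in> I" for t
      using F0 [OF that] smoothed_lines_rescaled [OF ij, of \<delta> t "\<phi> t"]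
      by (simp add: zero_locus_def x_def y_def F_def K_def power2_eq_square)
    have cross: "x' s * y'' s - x'' s * y' s = \<delta> ^ 3 * \<phi>'' s"
      by (simp add: x'_def x''_def y''_def power2_eq_square power3_eq_cube)
    define u where "u = real i + \<delta> * \<phi>' s"
    have y's: "y' s = \<delta> * u" by (simp add: y'_def u_def power2_eq_square algebra_simps)
    have sq: "(x' s)\<^sup>2 + (y' s)\<^sup>2 = \<delta>\<^sup>2 * (1 + u\<^sup>2)"
      unfolding y's by (simp add: x'_def power2_eq_square algebra_simps)
    have red: "\<delta> * v * (\<delta>\<^sup>2 * (1 + u\<^sup>2)) / (\<delta> ^ 3 * \<phi>'' s) = v * (1 + u\<^sup>2) / \<phi>'' s" for v
      using \<delta>(1) by (simp add: power2_eq_square power3_eq_cube)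
    define Y1 where "Y1 = y s + (1 + u\<^sup>2) / \<phi>'' s"
    have "x s - y' s * ((x' s)\<^sup>2 + (y' s)\<^sup>2) / (x' s * y'' s - x'' s * y' s) = C"
      unfolding sq cross unfolding y's red unfolding X [symmetric] by (simp add: x_def u_def)
    moreover have "y s + x' s * ((x' s)\<^sup>2 + (y' s)\<^sup>2) / (x' s * y'' s - x'' s * y' s) = Y1"
      unfolding sq cross Y1_def using red [of 1] by (simp add: x'_def)
    moreover have "x' s * y'' s - x'' s * y' s \<noteq> 0"
      unfolding cross using \<delta>(1) nz by simp
    ultimately have "(C, Y1) \<in> evolute (zero_locus {smoothed_lines d (\<delta> ^ 3)})"
      unfolding evolute_def using I x y on_curve by blast
    moreover have "Y1 = real i * real j + real i * (\<delta> * s) + \<delta>\<^sup>2 * \<phi> s + (1 + u\<^sup>2) / \<phi>'' s"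
      by (simp add: Y1_def y_def algebra_simps power2_eq_square)
    ultimately show "\<exists>Y. (C, Y) \<in> evolute (zero_locus {smoothed_lines d (\<delta> ^ 3)}) \<and>
       \<bar>Y - (real i * real j + (real i + real j - C0) / real i)\<bar> < \<sigma>"
      using Y by (auto simp: u_def)
  qed (rule \<eta>)
qed

section \<open>Counting the intersections\<close>

text \<open>
  For irrational \<open>C0\<close> the height determines \<open>i\<close> through its irrational part \<open>- C0 / i\<close>, and then \<open>j\<close>.
\<close>

lemma normal_heights_distinct:
  fixes C0 :: real
  assumes C0: "C0 \<notin> \<rat>"
  shows "inj_on (\<lambda>(i, j). real i * real j + (real i + real j - C0) / real i) ({1..} \<times> UNIV)"
proof (rule inj_onI, clarify)
  fix i j k l :: nat
  assume i: "1 \<le> i" and k: "1 \<le> k"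
    and eq: "real i * real j + (real i + real j - C0) / real i
      = real k * real l + (real k + real l - C0) / real k"
  have ik: "i = k"
  proof (rule ccontr)
    assume "i \<noteq> k"
    then have nz: "1 / real i - 1 / real k \<noteq> 0" using i k by (simp add: field_simps)
    define q where "q = real i * real j + (real i + real j) / real i
        - real k * real l - (real k + real l) / real k"
    have "C0 * (1 / real i - 1 / real k) = q"
      using eq by (simp add: q_def diff_divide_distrib right_diff_distrib)
    then have "C0 = q / (1 / real i - 1 / real k)" using nz by (simp add: eq_divide_eq)
    also have "\<dots> \<in> \<rat>" unfolding q_def by (intro Rats_divide Rats_diff Rats_add Rats_mult) auto
    finally show False using C0 by simp
  qed
  have "real j * (real i + 1 / real i) = real l * (real i + 1 / real i)"
    using eq i unfolding ik [symmetric] by (simp add: field_simps)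
  moreover have "real i + 1 / real i > 0" using i by (intro add_pos_nonneg) auto
  ultimately show "i = k \<and> j = l" using ik by simp
qed

lemma finite_positive_lower_bound:
  assumes "finite A" "\<And>a. a \<in> A \<Longrightarrow> g a > (0::real)"
  obtains e where "e > 0" "\<And>a. a \<in> A \<Longrightarrow> e \<le> g a"
proof
  show "Min (insert 1 (g ` A)) > 0" using assms by (subst Min_gr_iff) auto
  show "Min (insert 1 (g ` A)) \<le> g a" if "a \<in> A" for a
    using assms that by (intro Min_le) auto
qed

text \<open>
  The choices have to be made in the right order. The finitely many heights on the line \<open>x = C0\<close> fix the
  separation \<open>\<sigma>\<close>; this yields a common \<open>\<eta>\<close> such that for all \<open>\<delta> < \<eta>\<close> and all \<open>C\<close> closer to \<open>C0\<close> than \<open>\<eta>\<close> the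
  points of the evolute exist. Only then \<open>\<delta>\<close> and with it the curve is fixed, and \<open>C\<close> is chosen outside of the
  finitely many values that are not transversal for this curve.
\<close>

lemma evolute_R_degree_lower_bound:
  assumes d: "d > 0"
  obtains e where "0 < e" "e < 1"
    "enat (d * (d - 1)) \<le> R_degree (evolute (zero_locus {smoothed_lines d e}))"
proof -
  define Pr where "Pr = (SIGMA i:{1..d}. {1..d} - {i})"
  have finPr: "finite Pr" by (simp add: Pr_def)
  have cardPr: "card Pr = d * (d - 1)" by (simp add: Pr_def card_SigmaI)
  obtain C0 :: real where C0: "C0 \<notin> \<rat>"
    using uncountable_UNIV_real countable_rat by (metis UNIV_eq_I)
  define h where "h = (\<lambda>(i, j). real i * real j + (real i + real j - C0) / real i)"
  have inj: "inj_on h Pr"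
    unfolding h_def by (rule inj_on_subset [OF normal_heights_distinct [OF C0]]) (auto simp: Pr_def)
  obtain \<sigma> where \<sigma>: "\<sigma> > 0"
    and sep: "\<And>p q. p \<in> Pr \<Longrightarrow> q \<in> Pr \<Longrightarrow> p \<noteq> q \<Longrightarrow> \<sigma> \<le> \<bar>h p - h q\<bar>"
  proof -
    have fin: "finite (Pr \<times> Pr - Id)" using finPr by simp
    have pos: "\<bar>h (fst a) - h (snd a)\<bar> > 0" if "a \<in> Pr \<times> Pr - Id" for a
      using that inj_on_eq_iff [OF inj] by (cases a) simp
    obtain e where e: "e > 0" "\<And>a. a \<in> Pr \<times> Pr - Id \<Longrightarrow> e \<le> \<bar>h (fst a) - h (snd a)\<bar>"
      by (rule finite_positive_lower_bound
          [of "Pr \<times> Pr - Id" "\<lambda>a. \<bar>h (fst a) - h (snd a)\<bar>", OF fin pos], assumption, rule that)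
    show ?thesis
    proof (rule that [OF e(1)])
      fix p q assume "p \<in> Pr" "q \<in> Pr" "p \<noteq> q"
      then show "e \<le> \<bar>h p - h q\<bar>" using e(2) [of "(p, q)"] by simp
    qed
  qed
  have "\<exists>\<eta>>0. \<forall>\<delta> C. 0 < \<delta> \<longrightarrow> \<delta> < \<eta> \<longrightarrow> \<bar>C - C0\<bar> < \<eta> \<longrightarrow>
    (\<exists>Y. (C, Y) \<in> evolute (zero_locus {smoothed_lines d (\<delta> ^ 3)}) \<and> \<bar>Y - h p\<bar> < \<sigma> / 2)"
    if p: "p \<in> Pr" for p
  proof -
    obtain i j where "p = (i, j)" by force
    with p have ij: "p = (i, j)" "i \<in> {1..d}" "j \<in> {1..d}" "i \<noteq> j"
      by (auto simp: Pr_def)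
    have "C0 \<noteq> real i + real j" using C0 by (metis Rats_add Rats_of_nat)
    from evolute_near_node_normal [OF ij(2-4) this, of "\<sigma> / 2"] \<sigma>
    show ?thesis by (simp add: h_def ij(1))
  qed
  then obtain \<eta>f where \<eta>f: "\<And>p. p \<in> Pr \<Longrightarrow> \<eta>f p > 0"
    and near: "\<And>p \<delta> C. p \<in> Pr \<Longrightarrow> 0 < \<delta> \<Longrightarrow> \<delta> < \<eta>f p \<Longrightarrow> \<bar>C - C0\<bar> < \<eta>f p \<Longrightarrow>
      \<exists>Y. (C, Y) \<in> evolute (zero_locus {smoothed_lines d (\<delta> ^ 3)}) \<and> \<bar>Y - h p\<bar> < \<sigma> / 2"
    by metis
  obtain \<eta> where \<eta>: "\<eta> > 0" "\<And>p. p \<in> Pr \<Longrightarrow> \<eta> \<le> \<eta>f p"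
    by (rule finite_positive_lower_bound [of Pr \<eta>f, OF finPr \<eta>f], assumption, rule that)
  define \<delta> where "\<delta> = min \<eta> 1 / 2"
  have \<delta>: "0 < \<delta>" "\<delta> < \<eta>" "\<delta> < 1" using \<eta>(1) by (auto simp: \<delta>_def)
  define e where "e = \<delta> ^ 3"
  have e: "0 < e" "e < 1" using \<delta> by (auto simp: e_def power_less_one_iff)
  define f \<Gamma> where "f = smoothed_lines d e" and "\<Gamma> = zero_locus {f}"
  have monic: "degree f = d" "lead_coeff f = 1" "deg_le d f"
    unfolding f_def by (rule smoothed_lines_monic [OF d])+
  have f0: "f \<noteq> 0" using monic by auto
  have ideal: "vanishing_ideal \<Gamma> = {g. f dvd g}"
    unfolding \<Gamma>_def f_def by (rule smoothed_lines_vanishing_ideal [OF d e])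
  obtain r where r: "r \<noteq> 0"
    "\<And>c y. poly r c \<noteq> 0 \<Longrightarrow> eval2 f (c, y) = 0 \<Longrightarrow> eval2 (pderiv f) (c, y) \<noteq> 0"
    by (rule minimal_degree_generic_simple_zeros [of f \<Gamma>])
       (use f0 in \<open>auto simp: ideal intro: dvd_imp_degree_le\<close>)
  obtain P where P: "P \<noteq> 0" "P \<in> vanishing_ideal (evolute \<Gamma>)"
    using evolute_algebraic [of f r] monic d r unfolding \<Gamma>_def by auto
  obtain R where R: "R \<noteq> 0"
    "\<And>c. poly R c \<noteq> 0 \<Longrightarrow> meets_transversally {p. fst p = c} (evolute \<Gamma>)"
    using generic_vertical_line_transversal [OF P(2,1)] by metis
  have "infinite {C0 - \<eta><..<C0 + \<eta>}" using \<eta>(1) by (simp add: infinite_Ioo)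
  then obtain C where C: "C \<in> {C0 - \<eta><..<C0 + \<eta>}" "poly R C \<noteq> 0"
    using poly_roots_finite [OF R(1)] by (metis (mono_tags, lifting) finite_subset mem_Collect_eq subsetI)
  define L where "L = {p::real \<times> real. fst p = C}"
  have "\<exists>Y. (C, Y) \<in> evolute \<Gamma> \<and> \<bar>Y - h p\<bar> < \<sigma> / 2" if p: "p \<in> Pr" for p
  proof -
    have "\<bar>C - C0\<bar> < \<eta>" using C(1) by auto
    with \<eta>(2) [OF p] \<delta>(2) show ?thesis
      unfolding \<Gamma>_def f_def e_def by (intro near [OF p \<delta>(1)]) auto
  qed
  then obtain Y where Y: "\<And>p. p \<in> Pr \<Longrightarrow> (C, Y p) \<in> evolute \<Gamma>"
    "\<And>p. p \<in> Pr \<Longrightarrow> \<bar>Y p - h p\<bar> < \<sigma> / 2" by metis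
  have "inj_on (\<lambda>p. (C, Y p)) Pr"
  proof (rule inj_onI, rule ccontr)
    fix p q assume pq: "p \<in> Pr" "q \<in> Pr" "(C, Y p) = (C, Y q)" "p \<noteq> q"
    have "Y p = Y q" using pq(3) by simp
    then show False using sep [OF pq(1,2,4)] Y(2) [OF pq(1)] Y(2) [OF pq(2)] by linarith
  qed
  then have card: "card ((\<lambda>p. (C, Y p)) ` Pr) = d * (d - 1)"
    by (simp add: card_image cardPr)
  have sub: "(\<lambda>p. (C, Y p)) ` Pr \<subseteq> evolute \<Gamma> \<inter> L" using Y(1) by (auto simp: L_def)
  have "enat (d * (d - 1)) \<le> ecard (evolute \<Gamma> \<inter> L)"
    using card_mono [OF _ sub] by (auto simp: ecard_def card)
  also have "\<dots> \<le> R_degree (evolute \<Gamma>)"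
    unfolding R_degree_def using R(2) [OF C(2)] vertical_line [of C]
    by (intro SUP_upper) (auto simp: L_def)
  finally show ?thesis using that e by (simp add: \<Gamma>_def f_def)
qed

theorem proposition4p1:
  fixes d :: nat
  assumes "d \<ge> 3"
  shows "enat (d * (d - 2)) \<le> (SUP \<Gamma> \<in> {\<Gamma>. real_algebraic_curve d \<Gamma>}. R_degree (evolute \<Gamma>))"
proof -
  have d: "d > 0" using assms by simp
  obtain e where e: "0 < e" "e < 1"
    and bound: "enat (d * (d - 1)) \<le> R_degree (evolute (zero_locus {smoothed_lines d e}))"
    using evolute_R_degree_lower_bound [OF d] by metis
  have "enat (d * (d - 2)) \<le> enat (d * (d - 1))"
    by (simp add: diff_le_mono2)
  also note bound
  also have "R_degree (evolute (zero_locus {smoothed_lines d e}))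
      \<le> (SUP \<Gamma> \<in> {\<Gamma>. real_algebraic_curve d \<Gamma>}. R_degree (evolute \<Gamma>))"
    using smoothed_lines_curve [OF d e] by (intro SUP_upper) simp
  finally show ?thesis .
qed

end
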